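(* Let $F$ be a field with a valuation $v$, valuation ring $O_v$ and value group $\Gamma_v$, let $E/F$ be a finite field extension, and let $w$ be a quasi-valuation on $E$ extending $v$ such that $w(E\setminus\{0\})$ is torsion over $\Gamma_v$. Let $O_w=\{x\in E\mid w(x)\ge0\}$ and let $I_E(O_w)$ be the integral closure of $O_w$ in $E$. Then $$\text{K-dim}\,O_v\le|\mathrm{Spec}(O_w)|\le|\mathrm{Spec}(I_E(O_w))|\le[E:F]_{sep}\cdot\text{K-dim}\,O_v.$$
   Context: A totally ordered abelian monoid is a commutative monoid $(M,+)$ with a total order such that $a\le b$ implies $a+c\le b+c$. One adjoins $\infty$, greater than all elements of $M$, with $m+\infty=\infty$. A quasi-valuation on a ring $A$ is a function $w:A\to M\cup\{\infty\}$, $M$ a totally ordered abelian monoid, with $w(0)=\infty$, $w(xy)\ge w(x)+w(y)$ and $w(x+y)\ge\min\{w(x),w(y)\}$ for all $x,y\in A$. $w$ extends $v$ means that $w|_F=v$ (so $\Gamma_v$ is contained in $M$). For $0\neq x\in E$ one has $w(x)\neq\infty$. "$w(E\setminus\{0\})$ is torsion over $\Gamma_v$" means: for every $0\ne x\in E$ there is an integer $k\ge1$ with $k\,w(x)\in\Gamma_v$. For a ring $R$, $\text{K-dim}\,R$ denotes the classical Krull dimension of $R$, by which is meant the maximal length of the chains of prime ideals of $R$; $\mathrm{Spec}(R)$ is the set of prime ideals of $R$. $[E:F]_{sep}$ is the separable degree of $E/F$.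
   Formalization: The length of a chain of prime ideals counts the primes in it, so a field has K-dim 1; counting inclusions instead, the upper bound fails for E = F with v = w trivial, where |Spec| = 1 but K-dim O_v = 0. *)

theory Defs
  imports "HOL-Algebra.Algebraic_Closure_Type" "HOL-Library.Extended_Nat" "HOL-Library.Equipollence"
begin

section \<open>Adjoining infinity to a totally ordered abelian monoid\<close>

datatype 'm with_infty = Val 'm | Infty

instantiation with_infty :: (type) infinity
begin
definition infinity_with_infty :: "'a with_infty" where "\<infinity> = Infty"
instance ..
end

instantiation with_infty :: (linorder) linorder
begin

fun less_eq_with_infty :: "'a with_infty \<Rightarrow> 'a with_infty \<Rightarrow> bool" where
  "x \<le> Infty \<longleftrightarrow> True"
| "Infty \<le> Val b \<longleftrightarrow> False"
| "Val a \<le> Val b \<longleftrightarrow> a \<le> b"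

definition less_with_infty :: "'a with_infty \<Rightarrow> 'a with_infty \<Rightarrow> bool" where
  "(x :: 'a with_infty) < y \<longleftrightarrow> x \<le> y \<and> \<not> y \<le> x"

instance
proof
  fix x y z :: "'a with_infty"
  show "x < y \<longleftrightarrow> x \<le> y \<and> \<not> y \<le> x" by (rule less_with_infty_def)
  show "x \<le> x" by (cases x) auto
  show "x \<le> y \<Longrightarrow> y \<le> z \<Longrightarrow> x \<le> z" by (cases x; cases y; cases z) auto
  show "x \<le> y \<Longrightarrow> y \<le> x \<Longrightarrow> x = y" by (cases x; cases y) auto
  show "x \<le> y \<or> y \<le> x" by (cases x; cases y) auto
qed

end

instantiation with_infty :: (comm_monoid_add) comm_monoid_add
begin

definition zero_with_infty :: "'a with_infty" where "0 = Val 0"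

fun plus_with_infty :: "'a with_infty \<Rightarrow> 'a with_infty \<Rightarrow> 'a with_infty" where
  "Val a + Val b = Val (a + b)"
| "Infty + y = Infty"
| "x + Infty = Infty"

instance
proof
  fix x y z :: "'a with_infty"
  show "x + y + z = x + (y + z)" by (cases x; cases y; cases z) (auto simp: add.assoc)
  show "x + y = y + x" by (cases x; cases y) (auto simp: add.commute)
  show "0 + x = x" by (cases x) (auto simp: zero_with_infty_def)
qed

end


section \<open>Valuations and quasi-valuations\<close>

text \<open>The values of \<open>v\<close> outside the subfield \<open>F\<close> are irrelevant.\<close>

definition valuation :: "'a::field set \<Rightarrow> ('a \<Rightarrow> 'g::linordered_ab_group_add with_infty) \<Rightarrow> bool" where
  "valuation F v \<longleftrightarrow>
     (\<forall>x\<in>F. v x = \<infinity> \<longleftrightarrow> x = 0) \<and>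
     (\<forall>x\<in>F. \<forall>y\<in>F. v (x * y) = v x + v y) \<and>
     (\<forall>x\<in>F. \<forall>y\<in>F. v (x + y) \<ge> min (v x) (v y))"

definition value_group :: "'a::field set \<Rightarrow> ('a \<Rightarrow> 'g::linordered_ab_group_add with_infty) \<Rightarrow> 'g set" where
  "value_group F v = {\<gamma>. \<exists>x\<in>F - {0}. v x = Val \<gamma>}"

definition valuation_ring :: "'a::field set \<Rightarrow> ('a \<Rightarrow> 'g::linordered_ab_group_add with_infty) \<Rightarrow> 'a set" where
  "valuation_ring F v = {x \<in> F. v x \<ge> 0}"

definition quasi_valuation :: "('a::ring_1 \<Rightarrow> 'm::{linorder, ordered_comm_monoid_add} with_infty) \<Rightarrow> bool" where
  "quasi_valuation w \<longleftrightarrow>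
     w 0 = \<infinity> \<and>
     (\<forall>x y. w (x * y) \<ge> w x + w y) \<and>
     (\<forall>x y. w (x + y) \<ge> min (w x) (w y))"

definition quasi_valuation_ring :: "('a::ring_1 \<Rightarrow> 'm::{linorder, ordered_comm_monoid_add} with_infty) \<Rightarrow> 'a set" where
  "quasi_valuation_ring w = {x. w x \<ge> 0}"

text \<open>
  The inclusion of the value group into the monoid \<open>M\<close> as an ordered submonoid is rendered by an
  embedding \<open>\<iota>\<close>, since the two live on different types.
\<close>

definition ordered_monoid_embedding ::
  "'g::linordered_ab_group_add set \<Rightarrow> ('g \<Rightarrow> 'm::{linorder, ordered_comm_monoid_add}) \<Rightarrow> bool" where
  "ordered_monoid_embedding G \<iota> \<longleftrightarrow>
     \<iota> 0 = 0 \<and> (\<forall>a\<in>G. \<forall>b\<in>G. \<iota> (a + b) = \<iota> a + \<iota> b) \<and> strict_mono_on G \<iota>"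

definition torsion_over ::
  "('a::field \<Rightarrow> 'm::{linorder, ordered_comm_monoid_add} with_infty) \<Rightarrow> 'm set \<Rightarrow> bool" where
  "torsion_over w G \<longleftrightarrow> (\<forall>x. x \<noteq> 0 \<longrightarrow> (\<exists>k::nat. k \<ge> 1 \<and> (\<Sum>i = 1..k. w x) \<in> Val ` G))"


section \<open>Spectrum, Krull dimension, integral closure\<close>

text \<open>A subset of a field type, viewed as a ring in the sense of HOL-Algebra.\<close>

abbreviation subring_of_field :: "'a::field set \<Rightarrow> 'a ring" where
  "subring_of_field S \<equiv> ring_of_type_algebra\<lparr>carrier := S\<rparr>"

definition Spec :: "('a, 'b) ring_scheme \<Rightarrow> 'a set set" where
  "Spec R = {P. primeideal P R}"

text \<open>
  The length of a chain of prime ideals is the number of prime ideals in it, so a field has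
  dimension 1: since the zero ideal is a member of the spectrum, with the convention that counts
  inclusions the upper bound on the spectrum already fails for the trivial valuation.
\<close>

definition krull_dim :: "('a, 'b) ring_scheme \<Rightarrow> enat" where
  "krull_dim R = (SUP C \<in> {C. C \<subseteq> Spec R \<and> finite C \<and> (\<forall>P\<in>C. \<forall>Q\<in>C. P \<subseteq> Q \<or> Q \<subseteq> P)}. enat (card C))"

definition ecard :: "'a set \<Rightarrow> enat" where
  "ecard A = (if finite A then enat (card A) else \<infinity>)"

definition integral_closure :: "'a::field set \<Rightarrow> 'a set" where
  "integral_closure S =
     {x. \<exists>p::'a poly. (\<forall>i. Polynomial.coeff p i \<in> S) \<and> Polynomial.lead_coeff p = 1 \<and> poly p x = 0}"


section \<open>Field extensions\<close>

text \<open>The extension \<open>E/F\<close> is given by a field type (playing the role of \<open>E\<close>) and a subset \<open>F\<close>.\<close>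

definition finite_field_extension :: "'a::field set \<Rightarrow> bool" where
  "finite_field_extension F \<longleftrightarrow>
     subfield F (ring_of_type_algebra :: 'a ring) \<and>
     ring.finite_dimension (ring_of_type_algebra :: 'a ring) F UNIV"

text \<open>
  The separable degree is the number of \<open>F\<close>-embeddings of \<open>E\<close> into an algebraic closure of \<open>F\<close>.
  For algebraic \<open>E/F\<close>, the algebraic closure of \<open>E\<close> is one, with \<open>F\<close> embedded by \<^const>\<open>to_ac\<close>.
\<close>

definition separable_degree :: "'a::field set \<Rightarrow> nat" where
  "separable_degree F =
     card {\<sigma> \<in> ring_hom (ring_of_type_algebra :: 'a ring) (ring_of_type_algebra :: 'a alg_closure ring).
             \<forall>a\<in>F. \<sigma> a = to_ac a}"

end

theory Submission
  imports Defs
begin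

text \<open>
  As \<open>O\<^sub>w \<inter> F = O\<^sub>v\<close> and \<open>O\<^sub>v\<close> is a valuation ring of \<open>F\<close>, the ideal of
  \<open>O\<^sub>w\<close> generated by a prime \<open>P\<close> of \<open>O\<^sub>v\<close> consists of single products \<open>p r\<close> and hence meets
  \<open>O\<^sub>v\<close> in \<open>P\<close>; so some prime of \<open>O\<^sub>w\<close> lies over \<open>P\<close>. Integral closures in a field are
  intersections of valuation rings, and Chevalley's extension theorem supplies the primes above a
  given prime. For the upper bound let \<open>N\<close> be the integral closure of \<open>O\<^sub>v\<close> in \<open>E\<close>. A prime of
  an overring of \<open>N\<close> is determined by its trace on \<open>N\<close>, because \<open>N\<close> is a Pruefer ring. If \<open>W\<close>
  is a valuation ring of the algebraic closure with centre \<open>P\<close> on \<open>O\<^sub>v\<close>, then every prime \<open>q\<close>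
  of \<open>N\<close> over \<open>P\<close> is the centre of \<open>\<sigma>\<^sup>-\<^sup>1 W\<close> for some \<open>F\<close>-embedding \<open>\<sigma>\<close>: otherwise prime avoidance
  gives \<open>x \<in> q\<close> with no conjugate in the maximal ideal of \<open>W\<close>, although the product of the
  conjugates of \<open>x\<close> lies in \<open>q \<inter> O\<^sub>v = P\<close>. So at most \<open>[E:F]\<^sub>s\<^sub>e\<^sub>p\<close> primes lie over each of the
  primes of \<open>O\<^sub>v\<close>, which form a chain.
\<close>

section \<open>Subrings of a field\<close>

definition unital_subring :: "'a::field set \<Rightarrow> bool" where
  "unital_subring S \<longleftrightarrow> 0 \<in> S \<and> 1 \<in> S \<and> (\<forall>x\<in>S. - x \<in> S) \<and> (\<forall>x\<in>S. \<forall>y\<in>S. x + y \<in> S \<and> x * y \<in> S)"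

lemma unital_subringD:
  assumes "unital_subring S"
  shows "0 \<in> S" "1 \<in> S" "x \<in> S \<Longrightarrow> - x \<in> S" "x \<in> S \<Longrightarrow> y \<in> S \<Longrightarrow> x + y \<in> S"
    "x \<in> S \<Longrightarrow> y \<in> S \<Longrightarrow> x - y \<in> S" "x \<in> S \<Longrightarrow> y \<in> S \<Longrightarrow> x * y \<in> S"
  using assms unfolding unital_subring_def by (auto, metis diff_conv_add_uminus)

lemma unital_subring_power: "unital_subring S \<Longrightarrow> x \<in> S \<Longrightarrow> x ^ n \<in> S"
  by (induction n) (auto intro: unital_subringD)

lemma sum_closed:
  fixes f :: "'b \<Rightarrow> 'a::comm_monoid_add"
  assumes "0 \<in> S" "\<And>x y. x \<in> S \<Longrightarrow> y \<in> S \<Longrightarrow> x + y \<in> S" "\<And>i. i \<in> A \<Longrightarrow> f i \<in> S"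
  shows "sum f A \<in> S"
  using assms(3) by (induction A rule: infinite_finite_induct) (auto intro: assms(1,2))

lemma unital_subring_sum: "unital_subring S \<Longrightarrow> (\<And>i. i \<in> A \<Longrightarrow> f i \<in> S) \<Longrightarrow> sum f A \<in> S"
  by (rule sum_closed) (auto intro: unital_subringD)

lemma unital_subring_prod_mset:
  "unital_subring S \<Longrightarrow> (\<And>x. x \<in># M \<Longrightarrow> x \<in> S) \<Longrightarrow> prod_mset M \<in> S"
  by (induction M) (auto intro: unital_subringD)

lemma unital_subring_Union_chain:
  assumes "subset.chain A C" "C \<noteq> {}" "\<And>S. S \<in> C \<Longrightarrow> unital_subring S"
  shows "unital_subring (\<Union>C)"
proof -
  have dir: "\<exists>S\<in>C. x \<in> S \<and> y \<in> S" if xy: "x \<in> \<Union>C" "y \<in> \<Union>C" for x y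
  proof -
    from xy obtain S T where ST: "S \<in> C" "x \<in> S" "T \<in> C" "y \<in> T"
      by blast
    moreover have "S \<subseteq> T \<or> T \<subseteq> S"
      using subset.chain_total[OF assms(1) ST(1,3)] by blast
    ultimately show ?thesis
      by blast
  qed
  have "x + y \<in> \<Union>C" "x * y \<in> \<Union>C" if "x \<in> \<Union>C" "y \<in> \<Union>C" for x y
    using dir[OF that] unital_subringD(4,6)[OF assms(3)] by blast+
  moreover have "- x \<in> \<Union>C" if "x \<in> \<Union>C" for x
    using that unital_subringD(3)[OF assms(3)] by blast
  moreover have "0 \<in> \<Union>C" "1 \<in> \<Union>C"
    using assms(2) unital_subringD(1,2)[OF assms(3)] by blast+
  ultimately show ?thesis
    unfolding unital_subring_def by blast
qed

lemma unital_subring_Inter: "(\<And>S. S \<in> C \<Longrightarrow> unital_subring S) \<Longrightarrow> unital_subring (\<Inter>C)"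
  unfolding unital_subring_def by auto


section \<open>Polynomials with coefficients in a set\<close>

text \<open>Coefficients come from an arbitrary set, because ideals will occur in this place as well
  as subrings.\<close>

definition polys_over :: "'a::zero set \<Rightarrow> 'a poly set" where
  "polys_over S = {p. \<forall>i. Polynomial.coeff p i \<in> S}"

lemma polys_over_add:
  fixes S :: "'a::comm_monoid_add set"
  shows "(\<And>x y. x \<in> S \<Longrightarrow> y \<in> S \<Longrightarrow> x + y \<in> S) \<Longrightarrow> p \<in> polys_over S \<Longrightarrow> q \<in> polys_over S
    \<Longrightarrow> p + q \<in> polys_over S"
  by (auto simp: polys_over_def)

text \<open>Three coefficient sets are kept apart so that a polynomial over a ring times one over an
  ideal can be placed over the ideal again.\<close>

lemma polys_over_mult:
  fixes S :: "'a::comm_semiring_0 set"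
  assumes "0 \<in> S" "\<And>x y. x \<in> S \<Longrightarrow> y \<in> S \<Longrightarrow> x + y \<in> S" "\<And>x y. x \<in> T \<Longrightarrow> y \<in> U \<Longrightarrow> x * y \<in> S"
    and "p \<in> polys_over T" "q \<in> polys_over U"
  shows "p * q \<in> polys_over S"
  using assms(3-5) by (auto simp: polys_over_def coeff_mult intro!: sum_closed assms(1,2))

lemma polys_over_pCons: "0 \<in> S \<Longrightarrow> pCons a p \<in> polys_over S \<longleftrightarrow> a \<in> S \<and> p \<in> polys_over S"
  by (auto simp: polys_over_def coeff_pCons split: nat.splits)

lemma polys_over_0: "0 \<in> S \<Longrightarrow> 0 \<in> polys_over S"
  by (simp add: polys_over_def)

lemma polys_over_mono: "p \<in> polys_over S \<Longrightarrow> S \<subseteq> T \<Longrightarrow> p \<in> polys_over T"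
  by (auto simp: polys_over_def)

lemma polys_over_monom: "0 \<in> S \<Longrightarrow> a \<in> S \<Longrightarrow> Polynomial.monom a n \<in> polys_over S"
  by (auto simp: polys_over_def)

lemma poly_in_subring:
  "unital_subring S \<Longrightarrow> p \<in> polys_over S \<Longrightarrow> x \<in> S \<Longrightarrow> poly p x \<in> S"
  by (auto simp: poly_altdef polys_over_def intro!: unital_subring_sum unital_subringD unital_subring_power)

text \<open>For a subring \<open>S\<close> this is the ring S[x]; for an ideal \<open>J\<close> of a
  subring \<open>A\<close> it is the ideal of A[x] generated by \<open>J\<close>.\<close>

definition adjoin :: "'a::field set \<Rightarrow> 'a \<Rightarrow> 'a set" where
  "adjoin S x = (\<lambda>p. poly p x) ` polys_over S"

lemma adjoin_add:
  assumes "\<And>x y. x \<in> S \<Longrightarrow> y \<in> S \<Longrightarrow> x + y \<in> S" "y \<in> adjoin S x" "z \<in> adjoin S x"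
  shows "y + z \<in> adjoin S x"
proof -
  obtain p q where "y = poly p x" "p \<in> polys_over S" "z = poly q x" "q \<in> polys_over S"
    using assms(2,3) by (auto simp: adjoin_def)
  then show ?thesis
    unfolding adjoin_def using polys_over_add[OF assms(1)] by (intro image_eqI[of _ _ "p + q"]) auto
qed

lemma adjoin_mult:
  assumes "0 \<in> S" "\<And>x y. x \<in> S \<Longrightarrow> y \<in> S \<Longrightarrow> x + y \<in> S" "\<And>x y. x \<in> T \<Longrightarrow> y \<in> U \<Longrightarrow> x * y \<in> S"
    and "y \<in> adjoin T x" "z \<in> adjoin U x"
  shows "y * z \<in> adjoin S x"
proof -
  obtain p q where "y = poly p x" "p \<in> polys_over T" "z = poly q x" "q \<in> polys_over U"
    using assms(4,5) by (auto simp: adjoin_def)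
  then show ?thesis
    unfolding adjoin_def using polys_over_mult[OF assms(1-3)]
    by (intro image_eqI[of _ _ "p * q"]) auto
qed

lemma adjoin_incl: "0 \<in> S \<Longrightarrow> S \<subseteq> adjoin S x"
  by (auto simp: adjoin_def polys_over_pCons polys_over_0 intro!: image_eqI[of _ _ "[:_:]"])

lemma adjoin_gen: "0 \<in> S \<Longrightarrow> 1 \<in> S \<Longrightarrow> x \<in> adjoin S x"
  by (auto simp: adjoin_def polys_over_pCons polys_over_0 intro!: image_eqI[of _ _ "[:0,1:]"])

lemma unital_subring_adjoin:
  assumes "unital_subring S"
  shows "unital_subring (adjoin S x)"
proof -
  note S = unital_subringD[OF assms]
  have add: "y + z \<in> adjoin S x" if "y \<in> adjoin S x" "z \<in> adjoin S x" for y z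
    using adjoin_add[OF S(4) that] .
  have mult: "y * z \<in> adjoin S x" if "y \<in> adjoin S x" "z \<in> adjoin S x" for y z
    using adjoin_mult[OF S(1,4,6) that] .
  have incl: "S \<subseteq> adjoin S x"
    by (rule adjoin_incl[OF S(1)])
  have "- 1 \<in> adjoin S x"
    using S(2,3) incl by blast
  then have "- y \<in> adjoin S x" if "y \<in> adjoin S x" for y
    using mult[OF _ that, of "- 1"] by simp
  then show ?thesis
    unfolding unital_subring_def using incl S(1,2) add mult by blast
qed


section \<open>Valuation rings and Chevalley's extension theorem\<close>

text \<open>For a subring \<open>A\<close> containing \<open>P\<close> this is the ideal of
  \<open>A\<close> generated by \<open>P\<close>. Sums are built one product at a time, so that
  minimality and compactness along chains are plain inductions.\<close>

inductive_set gen_ideal :: "'a::field set \<Rightarrow> 'a set \<Rightarrow> 'a set" for P A where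
  zero: "0 \<in> gen_ideal P A"
| step: "p \<in> P \<Longrightarrow> a \<in> A \<Longrightarrow> y \<in> gen_ideal P A \<Longrightarrow> p * a + y \<in> gen_ideal P A"

lemma gen_ideal_add:
  "x \<in> gen_ideal P A \<Longrightarrow> y \<in> gen_ideal P A \<Longrightarrow> x + y \<in> gen_ideal P A"
  by (induction rule: gen_ideal.induct) (auto simp: add.assoc intro: gen_ideal.step)

lemma gen_ideal_mult:
  assumes "unital_subring A" "c \<in> A"
  shows "x \<in> gen_ideal P A \<Longrightarrow> c * x \<in> gen_ideal P A"
proof (induction rule: gen_ideal.induct)
  case (step p a y)
  then have "p * (c * a) + c * y \<in> gen_ideal P A"
    using assms by (intro gen_ideal.step) (auto intro: unital_subringD)
  then show ?case
    by (simp add: algebra_simps)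
qed (simp add: gen_ideal.zero)

lemma gen_ideal_subset:
  assumes "unital_subring A" "P \<subseteq> A"
  shows "x \<in> gen_ideal P A \<Longrightarrow> x \<in> A"
  by (induction rule: gen_ideal.induct) (use assms in \<open>auto intro: unital_subringD\<close>)

lemma gen_ideal_least:
  assumes "0 \<in> I" "\<And>x y. x \<in> I \<Longrightarrow> y \<in> I \<Longrightarrow> x + y \<in> I" "\<And>p a. p \<in> P \<Longrightarrow> a \<in> A \<Longrightarrow> p * a \<in> I"
  shows "gen_ideal P A \<subseteq> I"
proof
  show "x \<in> gen_ideal P A \<Longrightarrow> x \<in> I" for x
    by (induction rule: gen_ideal.induct) (auto intro: assms)
qed

lemma gen_ideal_prod: "p \<in> P \<Longrightarrow> a \<in> A \<Longrightarrow> p * a \<in> gen_ideal P A"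
  using gen_ideal.step[OF _ _ gen_ideal.zero] by force

text \<open>A member of the generated ideal is a finite sum, and its finitely many coefficients lie
  in one member of the chain. Hence \<open>1 \<notin> gen_ideal P A\<close> survives unions of
  chains, as Zorn's lemma requires.\<close>

lemma gen_ideal_Union_chain:
  assumes "subset.chain \<A> C" "C \<noteq> {}" "x \<in> gen_ideal P (\<Union>C)"
  shows "\<exists>A\<in>C. x \<in> gen_ideal P A"
  using assms(3)
proof (induction rule: gen_ideal.induct)
  case (step p a y)
  then obtain S T where ST: "S \<in> C" "a \<in> S" "T \<in> C" "y \<in> gen_ideal P T"
    by blast
  have mono: "gen_ideal P S' \<subseteq> gen_ideal P T'" if "S' \<subseteq> T'" for S' T' :: "'a set"
    by (rule gen_ideal_least) (use that in \<open>auto intro: gen_ideal.zero gen_ideal_add gen_ideal_prod\<close>)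
  have "S \<subseteq> T \<or> T \<subseteq> S"
    using subset.chain_total[OF assms(1) ST(1,3)] by blast
  then show ?case
    using ST step(1) mono by (meson gen_ideal.step subset_eq)
qed (use assms(2) gen_ideal.zero in blast)

section \<open>Valuation rings of the whole field and Chevalley's theorem\<close>

definition valring :: "'a::field set \<Rightarrow> bool" where
  "valring V \<longleftrightarrow> unital_subring V \<and> (\<forall>x. x \<in> V \<or> inverse x \<in> V)"

text \<open>For a valuation ring this is its maximal ideal. Zero is listed separately because
  \<open>inverse 0 = 0\<close> belongs to \<open>V\<close>.\<close>

definition nonunits :: "'a::field set \<Rightarrow> 'a set" where
  "nonunits V = {x. x = 0 \<or> inverse x \<notin> V}"

text \<open>The two relations say that 1 lies in J[x] and in J[1/x]. Multiplying the second by
  \<open>x ^ n\<close> and dividing by \<open>1 - b 0\<close> expresses \<open>x ^ n\<close> through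
  lower powers with coefficients in \<open>J\<close>; inserting this into the top term of the first
  relation lowers its degree.\<close>

lemma valring_degree_reduction:
  fixes x :: "'a::field"
  assumes "\<And>i. a i \<in> J" "(\<Sum>i\<le>n. a i * x ^ i) = 1"
    and "\<And>i. b i \<in> J" "(\<Sum>i\<le>m. b i * inverse x ^ i) = 1"
    and "m \<le> n" "x \<noteq> 0" "inverse (1 - b 0) \<in> A" "b 0 \<noteq> 1"
    and "0 \<in> J" "\<And>x y. x \<in> J \<Longrightarrow> y \<in> J \<Longrightarrow> x + y \<in> J"
    and J: "\<And>c x. c \<in> A \<Longrightarrow> x \<in> J \<Longrightarrow> c * x \<in> J" "J \<subseteq> A"
  shows "\<exists>c. (\<forall>i. c i \<in> J) \<and> (\<Sum>i<n. c i * x ^ i) = 1"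
proof -
  define u where "u = 1 - b 0"
  have u: "u \<noteq> 0" "inverse u \<in> A"
    using assms by (auto simp: u_def)
  define c where "c i = a i + (if n - m \<le> i then a n * (inverse u * b (n - i)) else 0)" for i
  have "c i \<in> J" for i
  proof -
    have "a n * (inverse u * b (n - i)) \<in> J"
      using assms(1,3) J u by blast
    then show ?thesis
      using assms(1,10) by (auto simp: c_def)
  qed
  moreover have "(\<Sum>i<n. c i * x ^ i) = 1"
  proof -
    have "(\<Sum>i<n. if n - m \<le> i then b (n - i) * x ^ i else 0) = (\<Sum>i\<in>{n-m..<n}. b (n - i) * x ^ i)"
      by (rule sum.mono_neutral_cong_right) auto
    also have "\<dots> = (\<Sum>j\<in>{1..m}. b j * x ^ (n - j))"
      by (rule sum.reindex_bij_witness[of _ "\<lambda>j. n - j" "\<lambda>i. n - i"]) (use assms(5) in auto)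
    also have "\<dots> = x ^ n * (\<Sum>j\<in>{1..m}. b j * inverse x ^ j)"
      unfolding sum_distrib_left
      by (rule sum.cong) (use assms(5,6) in \<open>auto simp: power_diff field_simps\<close>)
    also have "(\<Sum>j\<in>{1..m}. b j * inverse x ^ j) = u"
    proof -
      have "{..m} = insert 0 {1..m}"
        by auto
      then show ?thesis
        using assms(4) by (simp add: u_def algebra_simps)
    qed
    finally have *: "(\<Sum>i<n. if n - m \<le> i then b (n - i) * x ^ i else 0) = x ^ n * u" .
    have "(\<Sum>i<n. c i * x ^ i) = (\<Sum>i<n. a i * x ^ i) +
      a n * inverse u * (\<Sum>i<n. if n - m \<le> i then b (n - i) * x ^ i else 0)"
      unfolding sum_distrib_left sum.distrib[symmetric]
      by (rule sum.cong) (auto simp: c_def algebra_simps)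
    also have "\<dots> = (\<Sum>i\<le>n. a i * x ^ i)"
      using u unfolding * by (simp add: field_simps flip: lessThan_Suc_atMost)
    finally show ?thesis
      using assms(2) by simp
  qed
  ultimately show ?thesis
    by blast
qed

text \<open>Chevalley's theorem. Zorn's lemma gives a maximal overring \<open>A\<close> of
  \<open>R\<close> in which \<open>P\<close> generates a proper ideal \<open>J\<close>. If neither
  \<open>x\<close> nor \<open>inverse x\<close> were in \<open>A\<close>, then 1 would lie in J[x]
  and in J[1/x], and of two relations of minimal degree the longer one could still be
  shortened.\<close>

theorem exists_valring_above:
  assumes R: "unital_subring R" and P: "1 \<notin> gen_ideal P R" "P \<subseteq> R"
  shows "\<exists>V. valring V \<and> R \<subseteq> V \<and> P \<subseteq> nonunits V"
proof -
  define \<A> where "\<A> = {A. unital_subring A \<and> R \<subseteq> A \<and> 1 \<notin> gen_ideal P A}"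
  have "\<exists>A\<in>\<A>. \<forall>B\<in>\<A>. A \<subseteq> B \<longrightarrow> B = A"
  proof (rule subset_Zorn_nonempty)
    show "\<A> \<noteq> {}"
      using R P by (auto simp: \<A>_def)
  next
    fix C assume C: "C \<noteq> {}" "subset.chain \<A> C"
    then have sub: "C \<subseteq> \<A>"
      by (simp add: subset.chain_def)
    show "\<Union>C \<in> \<A>"
      using unital_subring_Union_chain[OF C(2,1)] gen_ideal_Union_chain[OF C(2,1)] sub C(1)
      unfolding \<A>_def by blast
  qed
  then obtain A where "A \<in> \<A>" and max: "\<And>B. B \<in> \<A> \<Longrightarrow> A \<subseteq> B \<Longrightarrow> B = A"
    by blast
  then have A: "unital_subring A" "R \<subseteq> A" "1 \<notin> gen_ideal P A"
    by (auto simp: \<A>_def)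
  define J where "J = gen_ideal P A"
  note AD = unital_subringD[OF A(1)]
  have J: "0 \<in> J" "\<And>x y. x \<in> J \<Longrightarrow> y \<in> J \<Longrightarrow> x + y \<in> J" "\<And>c x. c \<in> A \<Longrightarrow> x \<in> J \<Longrightarrow> c * x \<in> J"
    "J \<subseteq> A" "1 \<notin> J"
    using A P(2) gen_ideal_subset[OF A(1), of P]
    by (auto simp: J_def intro: gen_ideal.zero gen_ideal_add gen_ideal_mult)
  \<comment> \<open>By maximality of \<open>A\<close> the set \<open>P\<close> generates the unit
    ideal of A[x], and that ideal is contained in J[x].\<close>
  have one_in: "\<exists>p\<in>polys_over J. poly p x = 1" if x: "x \<notin> A" for x
  proof -
    have "gen_ideal P (adjoin A x) \<subseteq> adjoin J x"
    proof (rule gen_ideal_least)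
      fix p a assume "p \<in> P" "a \<in> adjoin A x"
      moreover have "p \<in> J" if "p \<in> P" for p
        using gen_ideal_prod[OF that AD(2)] by (simp add: J_def)
      then have "p \<in> adjoin J x" if "p \<in> P" for p
        using that adjoin_incl[OF J(1)] by blast
      ultimately have "p \<in> adjoin J x" "a \<in> adjoin A x"
        by blast+
      from adjoin_mult[OF J(1,2,3) this(2,1)] show "p * a \<in> adjoin J x"
        by (simp add: mult.commute)
    next
      show "0 \<in> adjoin J x"
        using J(1) adjoin_incl by blast
    qed (rule adjoin_add[OF J(2)])
    moreover have "adjoin A x \<notin> \<A>"
      using max[of "adjoin A x"] adjoin_incl[OF AD(1), of x] adjoin_gen[OF AD(1,2), of x] x
      by blast
    ultimately have "1 \<in> adjoin J x"
      using unital_subring_adjoin[OF A(1), of x] A(2) adjoin_incl[OF AD(1), of x]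
      unfolding \<A>_def by blast
    then show ?thesis
      by (auto simp: adjoin_def)
  qed
  have minus_J: "- y \<in> J" if "y \<in> J" for y
    using J(3)[of "-1" y] that AD by simp
  \<comment> \<open>If the inverse of \<open>u = 1 - y\<close> were missing from \<open>A\<close>,
    clearing denominators in a relation for it would put a power of \<open>u\<close> into
    \<open>J\<close>; but \<open>u\<close> is congruent to 1 modulo \<open>J\<close>.\<close>
  have unit: "inverse (1 - y) \<in> A" "y \<noteq> 1" if y: "y \<in> J" for y
  proof -
    show "y \<noteq> 1"
      using y J(5) by blast
    show "inverse (1 - y) \<in> A"
    proof (rule ccontr)
      assume "inverse (1 - y) \<notin> A"
      then obtain p where p: "p \<in> polys_over J" "poly p (inverse (1 - y)) = 1"
        using one_in by blast
      define u where "u = 1 - y"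
      define n where "n = Polynomial.degree p"
      have u: "u \<in> A" "u \<noteq> 0"
        using y J(4,5) AD by (auto simp: u_def)
      have "u ^ n = (\<Sum>i\<le>n. u ^ n * (Polynomial.coeff p i * inverse u ^ i))"
        using p(2) by (simp add: poly_altdef u_def n_def flip: sum_distrib_left)
      also have "\<dots> = (\<Sum>i\<le>n. u ^ (n - i) * Polynomial.coeff p i)"
        by (rule sum.cong) (use u in \<open>auto simp: power_diff field_simps\<close>)
      also have "\<dots> \<in> J"
        using p(1) J(3) unital_subring_power[OF A(1) u(1)]
        by (intro sum_closed J(1,2)) (auto simp: polys_over_def)
      finally have "u ^ n \<in> J" .
      moreover have "1 - u ^ k \<in> J" for k
      proof (induction k)
        case (Suc k)
        have "u * (1 - u ^ k) + y \<in> J"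
          by (intro J(2,3) u(1) Suc y)
        then show ?case
          by (simp add: u_def algebra_simps)
      qed (simp add: J(1))
      ultimately have "(1 - u ^ n) + u ^ n \<in> J"
        by (intro J(2))
      then show False
        using J(5) by simp
    qed
  qed
  \<comment> \<open>Stated for arbitrary \<open>x\<close>, so that it serves both \<open>x\<close>
    and \<open>inverse x\<close>, whichever has the longer minimal relation.\<close>
  have no_descent: False
    if p: "p \<in> polys_over J" "poly p x = 1"
      and min: "\<And>p'. p' \<in> polys_over J \<Longrightarrow> poly p' x = 1 \<Longrightarrow> Polynomial.degree p \<le> Polynomial.degree p'"
      and q: "q \<in> polys_over J" "poly q (inverse x) = 1"
      and le: "Polynomial.degree q \<le> Polynomial.degree p" and x: "x \<noteq> 0" for x p q
  proof -
    define n where "n = Polynomial.degree p"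
    have "\<exists>c. (\<forall>i. c i \<in> J) \<and> (\<Sum>i<n. c i * x ^ i) = 1"
    proof (rule valring_degree_reduction)
      show "(\<Sum>i\<le>n. Polynomial.coeff p i * x ^ i) = 1"
        using p(2) by (simp add: n_def poly_altdef)
      show "(\<Sum>i\<le>Polynomial.degree q. Polynomial.coeff q i * inverse x ^ i) = 1"
        using q(2) by (simp add: poly_altdef)
      show "Polynomial.degree q \<le> n"
        using le by (simp add: n_def)
      show "inverse (1 - Polynomial.coeff q 0) \<in> A" "Polynomial.coeff q 0 \<noteq> 1"
        using unit q by (auto simp: polys_over_def)
      show "Polynomial.coeff p i \<in> J" "Polynomial.coeff q i \<in> J" for i
        using p(1) q(1) by (auto simp: polys_over_def)
    qed (fact x J)+
    then obtain c where c: "\<And>i. c i \<in> J" "(\<Sum>i<n. c i * x ^ i) = 1"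
      by blast
    define p' where "p' = (\<Sum>i<n. Polynomial.monom (c i) i)"
    have cp': "Polynomial.coeff p' i = (if i < n then c i else 0)" for i
      using c by (auto simp: p'_def coeff_sum)
    \<comment> \<open>For \<open>n = 0\<close> the sum is empty and could not be 1. So
      \<open>p'\<close>, whose coefficients vanish from \<open>n\<close> on, has degree below
      \<open>n\<close>.\<close>
    have n: "n > 0"
      using c(2) by (cases n) auto
    have "p' \<in> polys_over J"
      using c(1) J(1) by (auto simp: polys_over_def cp')
    moreover have "poly p' x = 1"
      using c(2) by (simp add: p'_def poly_sum poly_monom)
    moreover have "Polynomial.degree p' < n"
      using n by (metis cp' leading_coeff_0_iff degree_0 linorder_not_less)
    ultimately show False
      using min[of p'] by (simp add: n_def)
  qed
  have "x \<in> A \<or> inverse x \<in> A" for x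
  proof (rule ccontr)
    assume *: "\<not> ?thesis"
    then have "x \<noteq> 0"
      using AD(1) by auto
    have ex_min: "\<exists>p. p \<in> polys_over J \<and> poly p z = 1 \<and>
      (\<forall>p'. p' \<in> polys_over J \<longrightarrow> poly p' z = 1 \<longrightarrow> Polynomial.degree p \<le> Polynomial.degree p')"
      if "z \<notin> A" for z
      using ex_has_least_nat[of "\<lambda>p. p \<in> polys_over J \<and> poly p z = 1" _ Polynomial.degree] one_in[OF that]
      by blast
    obtain p q where p: "p \<in> polys_over J" "poly p x = 1"
        "\<And>p'. p' \<in> polys_over J \<Longrightarrow> poly p' x = 1 \<Longrightarrow> Polynomial.degree p \<le> Polynomial.degree p'"
      and q: "q \<in> polys_over J" "poly q (inverse x) = 1"
        "\<And>p'. p' \<in> polys_over J \<Longrightarrow> poly p' (inverse x) = 1 \<Longrightarrow> Polynomial.degree q \<le> Polynomial.degree p'"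
      using ex_min[of x] ex_min[of "inverse x"] * by blast
    show False
    proof (cases "Polynomial.degree q \<le> Polynomial.degree p")
      case True
      then show False
        using no_descent[OF p q(1,2)] \<open>x \<noteq> 0\<close> by blast
    next
      case False
      then show False
        using no_descent[of q "inverse x" p, OF q] p(1,2) \<open>x \<noteq> 0\<close> by simp
    qed
  qed
  moreover have "p \<in> nonunits A" if p: "p \<in> P" for p
  proof -
    have "p * inverse p \<in> J" if "inverse p \<in> A"
      using gen_ideal_prod[OF p that] by (simp add: J_def)
    then show ?thesis
      using J(5) by (auto simp: nonunits_def)
  qed
  ultimately show ?thesis
    using A by (auto simp: valring_def)
qed


section \<open>Prime ideals and localisation\<close>

text \<open>Prime ideals expressed in the operations of the field type; closure under negation comes
  from multiplication by \<open>- 1\<close>. The lemma \<open>primeideal_iff_prime_in\<close> makes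
  the link with \<open>Spec\<close>.\<close>

definition prime_in :: "'a::field set \<Rightarrow> 'a set \<Rightarrow> bool" where
  "prime_in S P \<longleftrightarrow> P \<subseteq> S \<and> 0 \<in> P \<and> 1 \<notin> P \<and> (\<forall>x\<in>P. \<forall>y\<in>P. x + y \<in> P) \<and>
     (\<forall>s\<in>S. \<forall>x\<in>P. s * x \<in> P) \<and> (\<forall>a\<in>S. \<forall>b\<in>S. a * b \<in> P \<longrightarrow> a \<in> P \<or> b \<in> P)"

lemma prime_inD:
  assumes "prime_in S P"
  shows "P \<subseteq> S" "0 \<in> P" "1 \<notin> P" "x \<in> P \<Longrightarrow> y \<in> P \<Longrightarrow> x + y \<in> P" "s \<in> S \<Longrightarrow> x \<in> P \<Longrightarrow> s * x \<in> P"
    "a \<in> S \<Longrightarrow> b \<in> S \<Longrightarrow> a * b \<in> P \<Longrightarrow> a \<in> P \<or> b \<in> P"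
  using assms unfolding prime_in_def by blast+

lemma prime_in_uminus: "unital_subring S \<Longrightarrow> prime_in S P \<Longrightarrow> x \<in> P \<Longrightarrow> - x \<in> P"
  using prime_inD(5)[of S P "- 1" x] unital_subringD(2,3)[of S] by auto

lemma primeideal_iff_prime_in:
  fixes S :: "'a::field set"
  assumes S: "unital_subring S"
  shows "primeideal P (subring_of_field S) \<longleftrightarrow> prime_in S P"
proof -
  let ?R = "subring_of_field S"
  note SD = unital_subringD[OF S]
  note simps = ring_of_type_algebra_def
  have neg: "\<exists>y\<in>S. x + y = 0" if "x \<in> S" for x
    using SD(3)[OF that] by (intro bexI[of _ "- x"]) auto
  have cr: "cring ?R"
  proof (rule cringI)
    show "abelian_group ?R"
      by (rule abelian_groupI) (use SD neg in \<open>auto simp: simps algebra_simps\<close>)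
    show "Group.comm_monoid ?R"
      by (rule comm_monoidI) (use SD in \<open>auto simp: simps algebra_simps\<close>)
  qed (auto simp: simps algebra_simps)
  interpret R: cring ?R
    by (rule cr)
  have minus: "\<ominus>\<^bsub>?R\<^esub> x = - x" if "x \<in> S" for x
    using R.minus_equality[of "- x" x] that SD(3) by (simp add: simps)
  show ?thesis
  proof
    assume P: "primeideal P ?R"
    interpret P: primeideal P ?R
      by (rule P)
    have "1 \<notin> P"
      using P.I_notcarr P.one_imp_carrier by (auto simp: simps)
    then show "prime_in S P"
      unfolding prime_in_def
      using P.a_subset P.zero_closed P.a_closed P.I_l_closed P.I_prime by (auto simp: simps)
  next
    assume P: "prime_in S P"
    note PD = prime_inD[OF P]
    show "primeideal P ?R"
    proof (rule primeidealI)
      show "ideal P ?R"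
      proof (rule idealI)
        show "subgroup P (add_monoid ?R)"
        proof (rule R.add.subgroupI)
          show "P \<subseteq> carrier ?R" "P \<noteq> {}"
            using PD by (auto simp: simps)
        next
          fix a assume "a \<in> P"
          then show "\<ominus>\<^bsub>?R\<^esub> a \<in> P"
            using PD(1) prime_in_uminus[OF S P] by (auto simp: minus)
        next
          fix a b assume "a \<in> P" "b \<in> P"
          then show "a \<oplus>\<^bsub>?R\<^esub> b \<in> P"
            using PD(4) by (simp add: simps)
        qed
      next
        fix a x assume "a \<in> P" "x \<in> carrier ?R"
        then show "x \<otimes>\<^bsub>?R\<^esub> a \<in> P" "a \<otimes>\<^bsub>?R\<^esub> x \<in> P"
          using PD(5)[of x a] by (simp_all add: simps mult.commute)
      qed (rule R.ring_axioms)
    next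
      show "cring ?R"
        by (rule cr)
      show "carrier ?R \<noteq> P"
        using PD(3) SD(2) by (auto simp: simps)
      show "a \<in> P \<or> b \<in> P" if "a \<in> carrier ?R" "b \<in> carrier ?R" "a \<otimes>\<^bsub>?R\<^esub> b \<in> P" for a b
        using that PD(6) by (simp add: simps)
    qed
  qed
qed

lemma Spec_subring_of_field: "unital_subring S \<Longrightarrow> Spec (subring_of_field S) = {P. prime_in S P}"
  by (simp add: Spec_def primeideal_iff_prime_in)

lemma prime_in_Int: "prime_in V M \<Longrightarrow> unital_subring B \<Longrightarrow> B \<subseteq> V \<Longrightarrow> prime_in B (M \<inter> B)"
  unfolding prime_in_def by (auto 4 3 intro: unital_subringD simp: subset_eq)

lemma prime_in_nonunits:
  assumes V: "valring V"
  shows "prime_in V (nonunits V)"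
proof -
  have "unital_subring V"
    using V by (simp add: valring_def)
  note VD = unital_subringD[OF this]
  have tot: "x \<in> V \<or> inverse x \<in> V" for x
    using V by (simp add: valring_def)
  have ideal: "s * x \<in> nonunits V" if s: "s \<in> V" and x: "x \<in> nonunits V" for s x
  proof (cases "s * x = 0")
    case False
    have "inverse x \<in> V" if "inverse (s * x) \<in> V"
      using VD(6)[OF s that] False by (simp add: field_simps)
    then show ?thesis
      using x False by (auto simp: nonunits_def)
  qed (simp add: nonunits_def)
  \<comment> \<open>Of two nonzero nonunits one is a multiple of the other by an element of
    \<open>V\<close>, so their sum is a multiple of a nonunit. Only one of the two orders has to be
    treated.\<close>
  have add: "x + y \<in> nonunits V" if x: "x \<in> nonunits V" and y: "y \<in> nonunits V"
      and xy: "x * inverse y \<in> V" "y \<noteq> 0" for x y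
  proof -
    have "(1 + x * inverse y) * y = x + y"
      using xy(2) by (simp add: distrib_right)
    then show ?thesis
      using ideal[OF VD(4)[OF VD(2) xy(1)] y] by simp
  qed
  have "x + y \<in> nonunits V" if x: "x \<in> nonunits V" and y: "y \<in> nonunits V" for x y
    using tot[of "x * inverse y"] add[OF x y] add[OF y x] x y
    by (cases "x = 0"; cases "y = 0") (auto simp: field_simps add.commute)
  moreover have "a \<in> nonunits V \<or> b \<in> nonunits V"
    if "a \<in> V" "b \<in> V" "a * b \<in> nonunits V" for a b
    using that VD(6)[of "inverse a" "inverse b"] by (auto simp: nonunits_def field_simps)
  moreover have "nonunits V \<subseteq> V" "0 \<in> nonunits V" "1 \<notin> nonunits V"
    using tot VD(1,2) by (auto simp: nonunits_def)
  ultimately show ?thesis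
    unfolding prime_in_def using ideal by blast
qed

section \<open>Localisation and lying over\<close>

theorem exists_valring_localized:
  assumes B: "unital_subring B" and S: "S \<subseteq> B" "1 \<in> S" "\<And>s t. s \<in> S \<Longrightarrow> t \<in> S \<Longrightarrow> s * t \<in> S"
    and P: "P \<subseteq> B" "S \<inter> gen_ideal P B = {}"
  shows "\<exists>V. valring V \<and> B \<subseteq> V \<and> P \<subseteq> nonunits V \<and> S \<inter> nonunits V = {}"
proof -
  note BD = unital_subringD[OF B]
  have S0: "s \<noteq> 0" if "s \<in> S" for s
    using P(2) gen_ideal.zero that by blast
  \<comment> \<open>\<open>C\<close> is the localisation of \<open>B\<close> at \<open>S\<close>.
    Elements of \<open>S\<close> are units in \<open>C\<close>, hence also in every valuation ring
    containing \<open>C\<close>, so it remains to apply Chevalley's theorem to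
    \<open>C\<close>.\<close>
  define C where "C = {b * inverse s | b s. b \<in> B \<and> s \<in> S}"
  have CI: "x \<in> C" if "s \<in> S" "s * x \<in> B" for s x
    unfolding C_def using that S0[OF that(1)]
    by (intro CollectI exI[of _ "s * x"] exI[of _ s]) (auto simp: field_simps)
  have CE: "\<exists>s\<in>S. s * x \<in> B" if "x \<in> C" for x
  proof -
    obtain b s where "x = b * inverse s" "b \<in> B" "s \<in> S"
      using \<open>x \<in> C\<close> by (auto simp: C_def)
    then show ?thesis
      using S0[of s] by (intro bexI[of _ s]) (auto simp: mult.left_commute)
  qed
  have BC: "B \<subseteq> C"
    using CI[of 1] S(2) by auto
  have C: "unital_subring C"
    unfolding unital_subring_def
  proof (intro conjI ballI)
    show "0 \<in> C" "1 \<in> C"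
      using BC BD by blast+
    show "- x \<in> C" if "x \<in> C" for x
      using CE[OF that] CI BD(3) by force
  next
    fix x y assume xy: "x \<in> C" "y \<in> C"
    then obtain s t where st: "s \<in> S" "s * x \<in> B" "t \<in> S" "t * y \<in> B"
      using CE by blast
    then have "t * (s * x) + s * (t * y) \<in> B" "(s * x) * (t * y) \<in> B"
      using S(1) BD(4,6) by blast+
    then show "x + y \<in> C" "x * y \<in> C"
      using CI[OF S(3)[OF st(1,3)], of "x + y"] CI[OF S(3)[OF st(1,3)], of "x * y"]
      by (simp_all add: algebra_simps)
  qed
  \<comment> \<open>Clearing denominators carries the ideal generated in \<open>C\<close> back to
    \<open>B\<close>; if it contained 1, some element of \<open>S\<close> would lie in the ideal
    generated in \<open>B\<close>.\<close>
  have "gen_ideal P C \<subseteq> {y. \<exists>s\<in>S. s * y \<in> gen_ideal P B}"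
  proof (rule gen_ideal_least, goal_cases)
    case 1
    then show ?case
      using S(2) gen_ideal.zero by force
  next
    case (2 x y)
    then obtain s t where st: "s \<in> S" "s * x \<in> gen_ideal P B" "t \<in> S" "t * y \<in> gen_ideal P B"
      by blast
    then have "t * (s * x) + s * (t * y) \<in> gen_ideal P B"
      using S(1) gen_ideal_mult[OF B] gen_ideal_add by (meson subsetD)
    then show ?case
      using S(3)[OF st(1,3)] by (auto simp: algebra_simps intro!: bexI[of _ "s * t"])
  next
    case (3 p a)
    then obtain s where "s \<in> S" "s * a \<in> B"
      using CE by blast
    then show ?case
      using gen_ideal_prod[OF 3(1), of "s * a" B] by (auto simp: algebra_simps)
  qed
  then have "1 \<in> gen_ideal P C \<Longrightarrow> \<exists>s\<in>S. s * 1 \<in> gen_ideal P B"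
    by blast
  then have "1 \<notin> gen_ideal P C"
    using P(2) by auto
  then obtain V where V: "valring V" "C \<subseteq> V" "P \<subseteq> nonunits V"
    using exists_valring_above[OF C] P(1) BC by blast
  have "s \<notin> nonunits V" if "s \<in> S" for s
    using CI[OF that, of "inverse s"] S0[OF that] BD(2) V(2) by (auto simp: nonunits_def)
  then show ?thesis
    using V BC by blast
qed

text \<open>Localisation of \<open>C\<close> at the complement \<open>B - P\<close>: if the
  extension of \<open>P\<close> to \<open>C\<close> contracts to \<open>P\<close>, that complement
  avoids the extended ideal.\<close>

corollary exists_valring_lying_over:
  assumes "unital_subring B" "unital_subring C" "B \<subseteq> C" "prime_in B P" "gen_ideal P C \<inter> B \<subseteq> P"
  shows "\<exists>V. valring V \<and> C \<subseteq> V \<and> nonunits V \<inter> B = P"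
proof -
  note PD = prime_inD[OF assms(4)]
  have "s * t \<in> B - P" if "s \<in> B - P" "t \<in> B - P" for s t
    using that PD(6)[of s t] unital_subringD(6)[OF assms(1)] by blast
  moreover have "1 \<in> B - P"
    using PD(3) unital_subringD(2)[OF assms(1)] by blast
  ultimately have "\<exists>V. valring V \<and> C \<subseteq> V \<and> P \<subseteq> nonunits V \<and> (B - P) \<inter> nonunits V = {}"
    using assms(3,5) PD(1) by (intro exists_valring_localized[OF assms(2)]) auto
  then show ?thesis
    using PD(1) by blast
qed

corollary exists_valring_centre:
  assumes "unital_subring B" "prime_in B P"
  shows "\<exists>V. valring V \<and> B \<subseteq> V \<and> nonunits V \<inter> B = P"
proof (rule exists_valring_lying_over[OF assms(1,1) order_refl assms(2)])
  have "gen_ideal P B \<subseteq> P"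
  proof (rule gen_ideal_least)
    show "p * a \<in> P" if "p \<in> P" "a \<in> B" for p a
      using prime_inD(5)[OF assms(2) that(2,1)] by (simp add: mult.commute)
  qed (fact prime_inD[OF assms(2)])+
  then show "gen_ideal P B \<inter> B \<subseteq> P"
    by blast
qed


section \<open>Integral closure\<close>

text \<open>As \<open>x\<close> is not in \<open>R\<close>, the element \<open>inverse x\<close> is
  a nonunit of \<open>R\<close> and generates a proper ideal. Chevalley's theorem keeps it a nonunit
  in some \<open>V\<close>, which therefore misses \<open>x\<close>.\<close>

lemma exists_valring_avoiding:
  assumes R: "unital_subring R" and x: "inverse x \<in> R" "x \<notin> R"
  shows "\<exists>V. valring V \<and> R \<subseteq> V \<and> x \<notin> V"
proof -
  have x0: "x \<noteq> 0"
    using x unital_subringD(1)[OF R] by auto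
  have "gen_ideal {inverse x} R \<subseteq> (\<lambda>r. inverse x * r) ` R"
  proof (rule gen_ideal_least)
    show "0 \<in> (\<lambda>r. inverse x * r) ` R"
      using unital_subringD(1)[OF R] by force
    show "y + z \<in> (\<lambda>r. inverse x * r) ` R"
      if "y \<in> (\<lambda>r. inverse x * r) ` R" "z \<in> (\<lambda>r. inverse x * r) ` R" for y z
      using that unital_subringD(4)[OF R] by (auto simp flip: distrib_left)
  qed auto
  moreover have "inverse x * r \<noteq> 1" if "r \<in> R" for r
    using that x x0 by (auto simp: field_simps)
  ultimately have "1 \<notin> gen_ideal {inverse x} R"
    by force
  then obtain V where "valring V" "R \<subseteq> V" "inverse x \<in> nonunits V"
    using exists_valring_above[OF R] x(1) by blast
  then show ?thesis
    using x0 by (auto simp: nonunits_def)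
qed

text \<open>If \<open>V\<close> missed an integral \<open>x\<close>, dividing a monic equation by a
  power of \<open>x\<close> would write \<open>x\<close> as a polynomial in \<open>inverse x\<close>
  over \<open>V\<close>. Conversely, an \<open>x\<close> in all valuation rings over
  \<open>S\<close> lies in S[1/x], since otherwise one of them would avoid it; such an expression
  turns into a monic equation.\<close>

theorem integral_closure_eq_Inter_valring:
  assumes S: "unital_subring S"
  shows "integral_closure S = \<Inter>{V. valring V \<and> S \<subseteq> V}"
proof (intro equalityI subsetI)
  fix x assume "x \<in> integral_closure S"
  then obtain p where p: "\<And>i. Polynomial.coeff p i \<in> S" "Polynomial.lead_coeff p = 1" "poly p x = 0"
    by (auto simp: integral_closure_def)
  show "x \<in> \<Inter>{V. valring V \<and> S \<subseteq> V}"
  proof safe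
    fix V assume V: "valring V" "S \<subseteq> V"
    then have VD: "unital_subring V"
      by (simp add: valring_def)
    show "x \<in> V"
    proof (rule ccontr)
      assume x: "x \<notin> V"
      then have ix: "inverse x \<in> V" "x \<noteq> 0"
        using V VD by (auto simp: valring_def dest: unital_subringD)
      obtain n where n: "Polynomial.degree p = Suc n"
        using p(2,3) by (cases "Polynomial.degree p") (auto simp: poly_altdef)
      have "x * x ^ n = - (\<Sum>i\<le>n. Polynomial.coeff p i * x ^ i)"
        using p(2,3) n by (simp add: poly_altdef eq_neg_iff_add_eq_0 add.commute)
      then have "x = - (\<Sum>i\<le>n. Polynomial.coeff p i * x ^ i) * inverse x ^ n"
        using ix by (simp add: field_simps)
      also have "\<dots> = - (\<Sum>i\<le>n. Polynomial.coeff p i * inverse x ^ (n - i))"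
        unfolding mult_minus_left sum_distrib_right
        by (intro arg_cong[of _ _ uminus] sum.cong refl) (use ix in \<open>auto simp: power_diff field_simps\<close>)
      also have "\<dots> \<in> V"
        using p(1) V(2) ix
        by (intro unital_subringD(3,6)[OF VD] unital_subring_sum[OF VD] unital_subring_power[OF VD]) auto
      finally show False
        using x by blast
    qed
  qed
next
  fix x assume x: "x \<in> \<Inter>{V. valring V \<and> S \<subseteq> V}"
  note SD = unital_subringD[OF S]
  show "x \<in> integral_closure S"
  proof (cases "x = 0")
    case True
    then show ?thesis
      using SD(1,2) unfolding integral_closure_def
      by (intro CollectI exI[of _ "[:0, 1:]"]) (auto simp: coeff_pCons split: nat.splits)
  next
    case False
    define R where "R = adjoin S (inverse x)"
    have R: "unital_subring R" "S \<subseteq> R" "inverse x \<in> R"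
      using S SD by (auto simp: R_def adjoin_gen unital_subring_adjoin intro!: adjoin_incl[THEN subsetD])
    have "x \<in> R"
      using exists_valring_avoiding[OF R(1,3)] x R(2) by blast
    then obtain f where f: "f \<in> polys_over S" "x = poly f (inverse x)"
      by (auto simp: R_def adjoin_def)
    define n where "n = Polynomial.degree f"
    \<comment> \<open>These are the coefficients of X^(n+1) - X^n f(1/X); the value 1 beyond
      \<open>n\<close> is the leading coefficient at \<open>Suc n\<close>.\<close>
    define c where "c k = (if k \<le> n then - Polynomial.coeff f (n - k) else 1)" for k
    define p where "p = (\<Sum>k\<le>Suc n. Polynomial.monom (c k) k)"
    have cp: "Polynomial.coeff p k = (if k \<le> Suc n then c k else 0)" for k
      by (auto simp: p_def coeff_sum)
    have "Polynomial.degree p = Suc n"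
    proof (rule antisym)
      show "Polynomial.degree p \<le> Suc n"
        by (intro degree_le) (auto simp: cp)
      show "Suc n \<le> Polynomial.degree p"
        by (intro le_degree) (auto simp: cp c_def)
    qed
    then have "Polynomial.lead_coeff p = 1"
      by (simp add: cp c_def)
    moreover have "Polynomial.coeff p i \<in> S" for i
      using f(1) SD(1-3) by (auto simp: cp c_def polys_over_def)
    moreover have "poly p x = 0"
    proof -
      have "poly p x = (\<Sum>k\<le>n. c k * x ^ k) + x ^ Suc n"
        by (simp add: p_def poly_sum poly_monom c_def)
      also have "(\<Sum>k\<le>n. c k * x ^ k) = (\<Sum>i\<le>n. c (n - i) * x ^ (n - i))"
        by (rule sum.reindex_bij_witness[of _ "\<lambda>i. n - i" "\<lambda>i. n - i"]) auto
      also have "\<dots> = - (x ^ n * (\<Sum>i\<le>n. Polynomial.coeff f i * inverse x ^ i))"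
        unfolding sum_distrib_left sum_negf[symmetric]
        by (rule sum.cong) (use False in \<open>auto simp: c_def power_diff field_simps\<close>)
      also have "(\<Sum>i\<le>n. Polynomial.coeff f i * inverse x ^ i) = x"
        using f(2) by (simp add: poly_altdef n_def)
      finally show ?thesis
        by simp
    qed
    ultimately show ?thesis
      by (auto simp: integral_closure_def)
  qed
qed

lemma unital_subring_integral_closure:
  assumes "unital_subring S"
  shows "unital_subring (integral_closure S)"
  unfolding integral_closure_eq_Inter_valring[OF assms]
  by (rule unital_subring_Inter) (auto simp: valring_def)

lemma integral_closure_incl: "unital_subring S \<Longrightarrow> S \<subseteq> integral_closure S"
  by (auto simp: integral_closure_eq_Inter_valring)


section \<open>Embeddings into the algebraic closure\<close>

definition is_subfield :: "'a::field set \<Rightarrow> bool" where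
  "is_subfield L \<longleftrightarrow> unital_subring L \<and> (\<forall>x\<in>L. inverse x \<in> L)"

text \<open>Homomorphisms are total functions restricted to a set, since embeddings are extended
  through a tower of subfields of one type.\<close>

definition hom_on :: "'a::field set \<Rightarrow> ('a \<Rightarrow> 'b::field) \<Rightarrow> bool" where
  "hom_on L \<sigma> \<longleftrightarrow> \<sigma> 1 = 1 \<and> (\<forall>x\<in>L. \<forall>y\<in>L. \<sigma> (x + y) = \<sigma> x + \<sigma> y \<and> \<sigma> (x * y) = \<sigma> x * \<sigma> y)"

definition algebraic_over :: "'a::field set \<Rightarrow> 'a \<Rightarrow> bool" where
  "algebraic_over F x \<longleftrightarrow> (\<exists>p\<in>polys_over F. p \<noteq> 0 \<and> poly p x = 0)"

lemma hom_onD: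
  assumes "hom_on L \<sigma>" "unital_subring L"
  shows "\<sigma> 0 = 0" "\<sigma> 1 = 1" "x \<in> L \<Longrightarrow> y \<in> L \<Longrightarrow> \<sigma> (x + y) = \<sigma> x + \<sigma> y"
    "x \<in> L \<Longrightarrow> y \<in> L \<Longrightarrow> \<sigma> (x * y) = \<sigma> x * \<sigma> y" "x \<in> L \<Longrightarrow> \<sigma> (- x) = - \<sigma> x"
proof -
  show add: "\<sigma> (x + y) = \<sigma> x + \<sigma> y" and "\<sigma> (x * y) = \<sigma> x * \<sigma> y"
    if "x \<in> L" "y \<in> L" for x y
    using assms that by (auto simp: hom_on_def)
  show "\<sigma> 1 = 1"
    using assms by (auto simp: hom_on_def)
  show 0: "\<sigma> 0 = 0"
  proof -
    have "\<sigma> 0 + 0 = \<sigma> 0 + \<sigma> 0"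
      using add[of 0 0] unital_subringD(1)[OF assms(2)] by (simp only: add_0_left add_0_right)
    then show ?thesis
      by (simp only: add_left_cancel)
  qed
  show "\<sigma> (- x) = - \<sigma> x" if "x \<in> L"
    using add[OF that unital_subringD(3)[OF assms(2) that]] 0 by (simp add: eq_neg_iff_add_eq_0 add.commute)
qed

lemma hom_on_inverse:
  assumes "hom_on L \<sigma>" "is_subfield L" "x \<in> L"
  shows "\<sigma> (inverse x) = inverse (\<sigma> x)"
proof (cases "x = 0")
  case False
  have "\<sigma> (x * inverse x) = \<sigma> x * \<sigma> (inverse x)"
    using assms by (auto simp: hom_on_def is_subfield_def)
  then have "\<sigma> x * \<sigma> (inverse x) = 1"
    using assms(1) False by (simp add: hom_on_def)
  then show ?thesis
    by (metis inverse_unique)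
qed (use assms hom_onD(1)[of L \<sigma>] in \<open>auto simp: is_subfield_def\<close>)

lemma hom_on_eq_0_iff:
  assumes "hom_on L \<sigma>" "is_subfield L" "x \<in> L"
  shows "\<sigma> x = 0 \<longleftrightarrow> x = 0"
proof -
  have "\<sigma> x * \<sigma> (inverse x) = \<sigma> (x * inverse x)"
    using assms by (auto simp: hom_on_def is_subfield_def)
  then show ?thesis
    using assms hom_onD(1,2)[of L \<sigma>] by (cases "x = 0") (auto simp: is_subfield_def)
qed

lemma is_subfield_UNIV: "is_subfield UNIV"
  by (auto simp: is_subfield_def unital_subring_def)

lemma hom_on_sum:
  assumes "hom_on L \<sigma>" "unital_subring L" "\<And>i. i \<in> A \<Longrightarrow> f i \<in> L"
  shows "\<sigma> (sum f A) = (\<Sum>i\<in>A. \<sigma> (f i))"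
  using assms(3)
  by (induction A rule: infinite_finite_induct)
    (auto simp: hom_onD[OF assms(1,2)] unital_subring_sum[OF assms(2)])

lemma map_poly_hom_on:
  assumes \<sigma>: "hom_on L \<sigma>" "unital_subring L" and pq: "p \<in> polys_over L" "q \<in> polys_over L"
  shows "map_poly \<sigma> (p + q) = map_poly \<sigma> p + map_poly \<sigma> q"
    "map_poly \<sigma> (p * q) = map_poly \<sigma> p * map_poly \<sigma> q"
proof -
  note hom = hom_onD[OF \<sigma>]
  note LD = unital_subringD[OF \<sigma>(2)]
  have mem: "Polynomial.coeff p i \<in> L" "Polynomial.coeff q i \<in> L" for i
    using pq by (auto simp: polys_over_def)
  show "map_poly \<sigma> (p + q) = map_poly \<sigma> p + map_poly \<sigma> q"
    by (rule poly_eqI) (simp add: coeff_map_poly hom mem)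
  show "map_poly \<sigma> (p * q) = map_poly \<sigma> p * map_poly \<sigma> q"
    by (rule poly_eqI) (simp add: coeff_map_poly hom mem coeff_mult hom_on_sum[OF \<sigma>] LD)
qed

lemma poly_map_poly_hom_on:
  assumes \<sigma>: "hom_on L \<sigma>" "unital_subring L" and p: "p \<in> polys_over L" "x \<in> L"
  shows "\<sigma> (poly p x) = poly (map_poly \<sigma> p) (\<sigma> x)"
  using p(1)
proof (induction p)
  case (pCons a p)
  then have p: "a \<in> L" "p \<in> polys_over L"
    using polys_over_pCons unital_subringD(1)[OF \<sigma>(2)] by blast+
  have "x * poly p x \<in> L"
    using unital_subringD(6)[OF \<sigma>(2) \<open>x \<in> L\<close> poly_in_subring[OF \<sigma>(2) p(2) \<open>x \<in> L\<close>]] .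
  moreover have "map_poly \<sigma> (pCons a p) = pCons (\<sigma> a) (map_poly \<sigma> p)"
    by (rule map_poly_pCons) (use hom_onD(1)[OF \<sigma>] in auto)
  ultimately show ?case
    using hom_onD(3,4)[OF \<sigma>] p pCons.IH \<open>x \<in> L\<close> poly_in_subring[OF \<sigma>(2) p(2) \<open>x \<in> L\<close>] by simp
qed (use hom_onD(1)[OF \<sigma>] in auto)

text \<open>After powers of \<open>y\<close> are cancelled, an algebraic equation for
  \<open>y\<close> over \<open>F\<close> has a nonzero constant term \<open>a\<close>, and a + y
  p(y) = 0 yields the inverse of \<open>y\<close> as a polynomial in \<open>y\<close>.\<close>

lemma is_subfield_of_algebraic:
  assumes "unital_subring R" "is_subfield F" "F \<subseteq> R" "\<And>x. algebraic_over F x"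
  shows "is_subfield R"
  unfolding is_subfield_def
proof (intro conjI ballI assms(1))
  fix y assume y: "y \<in> R"
  note RD = unital_subringD[OF assms(1)]
  note FD = assms(2)[unfolded is_subfield_def, THEN conjunct1, THEN unital_subringD(1)]
  have step: "inverse y \<in> R"
    if "p \<in> polys_over F" "p \<noteq> 0" "poly p y = 0" "y \<noteq> 0" for p
    using that
  proof (induction p)
    case (pCons a p)
    then have p: "a \<in> F" "p \<in> polys_over F"
      using polys_over_pCons FD by blast+
    have mem: "poly p y \<in> R"
      using poly_in_subring[OF assms(1) polys_over_mono[OF p(2) assms(3)] y] .
    show ?case
    proof (cases "a = 0")
      case True
      then show ?thesis
        using pCons p by simp
    next
      case False
      have "inverse y = - (inverse a * poly p y)"
        using pCons.prems(3,4) False by (simp add: field_simps eq_neg_iff_add_eq_0)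
      moreover have "inverse a \<in> R"
        using p(1) assms(2,3) by (auto simp: is_subfield_def)
      ultimately show ?thesis
        using mem RD by auto
    qed
  qed simp
  show "inverse y \<in> R"
    using assms(4)[of y] step RD(1) by (cases "y = 0") (auto simp: algebraic_over_def)
qed

lemma exists_min_poly:
  assumes "algebraic_over L x"
  shows "\<exists>p\<in>polys_over L. p \<noteq> 0 \<and> poly p x = 0 \<and>
    (\<forall>q\<in>polys_over L. q \<noteq> 0 \<longrightarrow> poly q x = 0 \<longrightarrow> Polynomial.degree p \<le> Polynomial.degree q)"
  using assms ex_has_least_nat[of "\<lambda>p. p \<in> polys_over L \<and> p \<noteq> 0 \<and> poly p x = 0" _ Polynomial.degree]
  unfolding algebraic_over_def by blast

text \<open>The extension sends f(x) to the value at \<open>\<beta>\<close> of the transported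
  polynomial. It is well defined because every \<open>f\<close> vanishing at \<open>x\<close> is a
  multiple of the minimal polynomial \<open>p\<close>, whose transport vanishes at
  \<open>\<beta>\<close>.\<close>

lemma hom_on_adjoin:
  fixes \<sigma> :: "'a::field \<Rightarrow> 'b::field"
  assumes L: "is_subfield L" and \<sigma>: "hom_on L \<sigma>"
    and p: "p \<in> polys_over L" "p \<noteq> 0" "poly p x = 0"
    and min: "\<And>q. q \<in> polys_over L \<Longrightarrow> q \<noteq> 0 \<Longrightarrow> poly q x = 0 \<Longrightarrow> Polynomial.degree p \<le> Polynomial.degree q"
    and \<beta>: "poly (map_poly \<sigma> p) \<beta> = 0"
  shows "\<exists>\<tau>. hom_on (adjoin L x) \<tau> \<and> (\<forall>y\<in>L. \<tau> y = \<sigma> y) \<and> \<tau> x = \<beta>"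
proof -
  have L': "unital_subring L"
    using L by (simp add: is_subfield_def)
  note LD = unital_subringD[OF L']
  note hom = hom_onD[OF \<sigma> L']
  define h where "h f = poly (map_poly \<sigma> f) \<beta>" for f
  have h_add: "h (f + g) = h f + h g" and h_mult: "h (f * g) = h f * h g"
    if "f \<in> polys_over L" "g \<in> polys_over L" for f g
    using map_poly_hom_on[OF \<sigma> L' that] by (simp_all add: h_def)
  have uminus_over: "- f \<in> polys_over L" if "f \<in> polys_over L" for f
    using that LD(3) by (auto simp: polys_over_def)
  have mult_over: "f * g \<in> polys_over L" if "f \<in> polys_over L" "g \<in> polys_over L" for f g
    using polys_over_mult[OF LD(1,4,6) that] .
  have deg_p: "Polynomial.degree p > 0"
    using p(2,3) by (intro Nat.gr0I) (auto elim!: degree_eq_zeroE)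
  have vanish: "h f = 0" if "f \<in> polys_over L" "poly f x = 0" for f
    using that
  proof (induction "Polynomial.degree f" arbitrary: f rule: less_induct)
    case less
    show ?case
    proof (cases "f = 0")
      case False
      \<comment> \<open>One step of polynomial division: \<open>k\<close> is a multiple of
        \<open>p\<close> with the leading term of \<open>f\<close>, so \<open>f - k\<close> has
        smaller degree or is zero.\<close>
      define d where "d = Polynomial.degree f - Polynomial.degree p"
      have le: "Polynomial.degree p \<le> Polynomial.degree f"
        using min less.prems False by blast
      define c where "c = Polynomial.lead_coeff f * inverse (Polynomial.lead_coeff p)"
      define k where "k = Polynomial.monom c d * p"
      have "c \<in> L"
        using less.prems(1) p(1) L LD(6) by (auto simp: c_def polys_over_def is_subfield_def)
      then have k: "k \<in> polys_over L"
        unfolding k_def using p(1) LD(1) by (intro mult_over polys_over_monom)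
      define g where "g = f + (- k)"
      have g: "g \<in> polys_over L"
        unfolding g_def using less.prems(1) k uminus_over polys_over_add[OF LD(4)] by blast
      have "Polynomial.degree k \<le> Polynomial.degree f"
        unfolding k_def using degree_mult_le[of "Polynomial.monom c d" p] degree_monom_le[of c d] le
        by (simp add: d_def)
      then have "Polynomial.degree g \<le> Polynomial.degree f"
        unfolding g_def by (intro degree_add_le) auto
      moreover have "Polynomial.coeff k (d + Polynomial.degree p) = Polynomial.lead_coeff f"
        unfolding k_def using p(2) by (simp add: coeff_monom_mult c_def)
      then have "Polynomial.coeff g (Polynomial.degree f) = 0"
        using le by (simp add: g_def d_def)
      ultimately have "g = 0 \<or> Polynomial.degree g < Polynomial.degree f"
        by (rule eq_zero_or_degree_less)
      moreover have "poly g x = 0"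
        using less.prems(2) p(3) by (simp add: g_def k_def)
      ultimately have "h g = 0"
        using less.hyps[of g] g by (auto simp: h_def)
      moreover have "h k = 0"
        using h_mult[OF polys_over_monom[OF LD(1) \<open>c \<in> L\<close>] p(1), of d] \<beta> by (simp add: k_def h_def)
      moreover have "f = g + k"
        by (simp add: g_def)
      ultimately show ?thesis
        using h_add[OF g k] by simp
    qed (simp add: h_def)
  qed
  \<comment> \<open>An arbitrary representing polynomial is chosen; by \<open>vanish\<close> two
    representatives have the same image.\<close>
  define \<tau> where "\<tau> y = h (SOME f. f \<in> polys_over L \<and> poly f x = y)" for y
  have \<tau>: "\<tau> (poly f x) = h f" if f: "f \<in> polys_over L" for f
  proof -
    define g where "g = (SOME g. g \<in> polys_over L \<and> poly g x = poly f x)"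
    have g: "g \<in> polys_over L" "poly g x = poly f x"
      using someI[of "\<lambda>g. g \<in> polys_over L \<and> poly g x = poly f x" f] f by (auto simp: g_def)
    have "h (g + (- f)) = 0"
      using g f by (intro vanish polys_over_add[OF LD(4)] uminus_over) auto
    moreover have "h (g + (- f) + f) = h (g + (- f)) + h f"
      using g f by (intro h_add polys_over_add[OF LD(4)] uminus_over) auto
    ultimately show ?thesis
      by (simp add: \<tau>_def g_def)
  qed
  have const: "\<tau> y = \<sigma> y" if "y \<in> L" for y
    using \<tau>[of "[:y:]"] that LD(1) hom(1)
    by (simp add: polys_over_pCons polys_over_0 h_def map_poly_pCons)
  have "hom_on (adjoin L x) \<tau>"
    unfolding hom_on_def
  proof (intro conjI ballI)
    show "\<tau> 1 = 1"
      using const[OF LD(2)] hom(2) by simp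
  next
    fix y z assume "y \<in> adjoin L x" "z \<in> adjoin L x"
    then obtain f g where fg: "f \<in> polys_over L" "y = poly f x" "g \<in> polys_over L" "z = poly g x"
      by (auto simp: adjoin_def)
    then show "\<tau> (y + z) = \<tau> y + \<tau> z" "\<tau> (y * z) = \<tau> y * \<tau> z"
      using \<tau>[of "f + g"] \<tau>[of "f * g"] \<tau>[of f] \<tau>[of g] polys_over_add[OF LD(4), of f g] mult_over[of f g]
      by (simp_all add: h_add h_mult)
  qed
  moreover have "\<tau> x = \<beta>"
    using \<tau>[of "[:0, 1:]"] LD(1,2) hom(1,2)
    by (simp add: polys_over_pCons polys_over_0 h_def map_poly_pCons)
  ultimately show ?thesis
    using const by blast
qed

text \<open>The elements are adjoined one at a time. The transported minimal polynomial keeps its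
  positive degree, so it has a root in the algebraically closed target, to which the next element is
  sent.\<close>

lemma hom_on_extend_list:
  fixes \<sigma> :: "'a::field \<Rightarrow> 'b::alg_closed_field"
  assumes F: "is_subfield F" "\<And>x. algebraic_over F x"
    and "is_subfield L" "F \<subseteq> L" "hom_on L \<sigma>"
  shows "\<exists>L' \<tau>. is_subfield L' \<and> L \<subseteq> L' \<and> set xs \<subseteq> L' \<and> hom_on L' \<tau> \<and> (\<forall>y\<in>L. \<tau> y = \<sigma> y)"
proof (induction xs)
  case Nil
  then show ?case
    using assms by auto
next
  case (Cons x xs)
  then obtain M \<tau> where M: "is_subfield M" "L \<subseteq> M" "set xs \<subseteq> M" "hom_on M \<tau>" "\<And>y. y \<in> L \<Longrightarrow> \<tau> y = \<sigma> y"
    by blast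
  have M': "unital_subring M" "0 \<in> M" "1 \<in> M"
    using M(1) by (auto simp: is_subfield_def dest: unital_subringD)
  have "algebraic_over M x"
    using F(2)[of x] polys_over_mono[of _ F M] assms(4) M(2) unfolding algebraic_over_def by blast
  then obtain p where p: "p \<in> polys_over M" "p \<noteq> 0" "poly p x = 0"
      "\<And>q. q \<in> polys_over M \<Longrightarrow> q \<noteq> 0 \<Longrightarrow> poly q x = 0 \<Longrightarrow> Polynomial.degree p \<le> Polynomial.degree q"
    using exists_min_poly by blast
  have "Polynomial.degree p > 0"
    using p(2,3) by (intro Nat.gr0I) (auto elim!: degree_eq_zeroE)
  moreover have "Polynomial.degree (map_poly \<tau> p) = Polynomial.degree p"
    using p(1) M p(2) by (intro map_poly_degree_eq) (simp add: hom_on_eq_0_iff polys_over_def)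
  ultimately obtain \<beta> where "poly (map_poly \<tau> p) \<beta> = 0"
    using alg_closed_imp_poly_has_root[of "map_poly \<tau> p"] by auto
  then obtain \<tau>' where \<tau>': "hom_on (adjoin M x) \<tau>'" "\<And>y. y \<in> M \<Longrightarrow> \<tau>' y = \<tau> y"
    using hom_on_adjoin[OF M(1,4) p] by blast
  have incl: "M \<subseteq> adjoin M x" "x \<in> adjoin M x"
    using adjoin_incl adjoin_gen M' by blast+
  have "is_subfield (adjoin M x)"
    using incl M(2) assms(4) unital_subring_adjoin[OF M'(1)] F
    by (intro is_subfield_of_algebraic[OF _ F(1)]) auto
  then show ?case
    using \<tau>' incl M by (intro exI[of _ "adjoin M x"] exI[of _ \<tau>']) auto
qed

definition embeddings :: "'a::field set \<Rightarrow> ('a \<Rightarrow> 'a alg_closure) set" where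
  "embeddings F = {\<sigma>. hom_on UNIV \<sigma> \<and> (\<forall>a\<in>F. \<sigma> a = to_ac a)}"

lemma separable_degree_eq: "separable_degree F = card (embeddings F)"
proof -
  have "{\<sigma> \<in> ring_hom (ring_of_type_algebra :: 'a ring) (ring_of_type_algebra :: 'a alg_closure ring).
             \<forall>a\<in>F. \<sigma> a = to_ac a} = embeddings F" for F :: "'a::field set"
    by (auto simp: embeddings_def ring_hom_def ring_of_type_algebra_def hom_on_def)
  then show ?thesis
    by (simp add: separable_degree_def)
qed

lemma hom_on_to_ac: "hom_on L to_ac"
  by (simp add: hom_on_def)

lemma is_subfield_of_subfield:
  assumes "subfield F (ring_of_type_algebra :: 'a::field ring)"
  shows "is_subfield F"
proof -
  let ?R = "ring_of_type_algebra :: 'a ring"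
  interpret R: field ?R
    by (rule field_from_type_algebra)
  have F: "subring F ?R"
    using subfieldE(1)[OF assms] .
  note simps = ring_of_type_algebra_def
  have minus: "\<ominus>\<^bsub>?R\<^esub> x = - x" for x :: 'a
    using R.minus_equality[of "- x" x] by (simp add: simps)
  have inv: "inv\<^bsub>?R\<^esub> x = inverse x" if "x \<noteq> 0" for x :: 'a
    by (rule R.comm_inv_char) (use that in \<open>auto simp: simps\<close>)
  have "inverse x \<in> F" if "x \<in> F" for x
  proof (cases "x = 0")
    case False
    then have "x \<in> F - {\<zero>\<^bsub>?R\<^esub>}"
      using that by (simp add: simps)
    then have "inv\<^bsub>?R\<^esub> x \<in> F"
      using R.subfield_m_inv(1)[OF assms] by blast
    then show ?thesis
      using inv[OF False] by simp
  qed (use that in simp)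
  moreover have "unital_subring F"
    unfolding unital_subring_def
    using subringE(2,3,5,6,7)[OF F] minus by (auto simp: simps)
  ultimately show ?thesis
    by (simp add: is_subfield_def)
qed

section \<open>Embeddings and norms of a finite extension\<close>

context
  fixes F :: "'a::field set"
  assumes fin: "finite_field_extension F"
begin

lemma ext_is_subfield: "is_subfield F"
  by (rule is_subfield_of_subfield) (use fin in \<open>simp add: finite_field_extension_def\<close>)

lemma ext_algebraic: "algebraic_over F x"
proof -
  let ?R = "ring_of_type_algebra :: 'a ring"
  interpret R: field ?R
    by (rule field_from_type_algebra)
  note simps = ring_of_type_algebra_def
  have F: "subfield F ?R" "ring.finite_dimension ?R F UNIV"
    using fin by (auto simp: finite_field_extension_def)
  have c: "carrier ?R = UNIV"
    by (simp add: simps)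
  have "subring UNIV ?R"
    using R.carrier_is_subring by (simp add: c)
  then have "(R.algebraic over F) x"
    using R.finite_dimension_imp_algebraic[OF F(1) _ F(2)] by simp
  then obtain p where p: "p \<in> carrier (univ_poly ?R F)" "p \<noteq> []" "R.eval p x = \<zero>\<^bsub>?R\<^esub>"
    using R.algebraicE[OF subfieldE(1)[OF F(1)], of x] c by auto
  have pow: "x [^]\<^bsub>?R\<^esub> n = x ^ n" for x :: 'a and n :: nat
    by (induction n) (auto simp: simps)
  \<comment> \<open>HOL-Algebra lists the coefficients from the leading one down, whereas
    \<open>Poly\<close> starts with the constant one; hence \<open>rev\<close>.\<close>
  have eval: "R.eval q x = poly (Poly (rev q)) x" for q
    by (induction q) (auto simp: simps[symmetric] pow Poly_append poly_monom, simp_all add: simps)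
  have "set p \<subseteq> F" "hd p \<noteq> 0"
    using p by (auto simp: univ_poly_def polynomial_def simps)
  have F0: "0 \<in> F"
    using ext_is_subfield by (auto simp: is_subfield_def dest: unital_subringD)
  have "Poly (rev p) \<in> polys_over F"
    using \<open>set p \<subseteq> F\<close> F0 by (auto simp: polys_over_def nth_default_def coeff_Poly_eq rev_nth intro!: subsetD[OF \<open>set p \<subseteq> F\<close>] nth_mem)
  moreover have "Poly (rev p) \<noteq> 0"
  proof
    assume "Poly (rev p) = 0"
    then have "Polynomial.coeff (Poly (rev p)) (length p - 1) = 0"
      by simp
    then show False
      using p(2) \<open>hd p \<noteq> 0\<close> by (simp add: nth_default_def rev_nth hd_conv_nth)
  qed
  moreover have "poly (Poly (rev p)) x = 0"
    using p(3) eval[of p] by (simp add: simps)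
  ultimately show ?thesis
    by (auto simp: algebraic_over_def)
qed

text \<open>\<open>xs\<close> spans the extension over \<open>F\<close>. The criterion speaks of
  closed sets, so that it applies to a subfield as well as to the set on which two embeddings
  agree.\<close>

lemma ext_finitely_generated:
  "\<exists>xs. \<forall>S. F \<subseteq> S \<longrightarrow> set xs \<subseteq> S \<longrightarrow> (\<forall>x\<in>S. \<forall>y\<in>S. x + y \<in> S \<and> x * y \<in> S) \<longrightarrow> S = UNIV"
proof -
  let ?R = "ring_of_type_algebra :: 'a ring"
  interpret R: field ?R
    by (rule field_from_type_algebra)
  note simps = ring_of_type_algebra_def
  have "R.finite_dimension F UNIV"
    using fin by (auto simp: finite_field_extension_def)
  then obtain xs where xs: "R.Span F xs = UNIV"
    using R.exists_base[OF ] fin unfolding R.finite_dimension_def finite_field_extension_def by metis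
  have F0: "0 \<in> F"
    using ext_is_subfield by (auto simp: is_subfield_def dest: unital_subringD)
  have "R.Span F ys \<subseteq> S"
    if "F \<subseteq> S" "set ys \<subseteq> S" "\<forall>x\<in>S. \<forall>y\<in>S. x + y \<in> S \<and> x * y \<in> S" for S ys
    using that(2)
  proof (induction ys)
    case Nil
    have "R.Span F [] = {0}"
      unfolding R.Span.simps by (simp add: simps)
    then show ?case
      using F0 that(1) by auto
  next
    case (Cons y ys)
    have "R.Span F (y # ys) = R.line_extension F y (R.Span F ys)"
      by simp
    also have "\<dots> = {a * y + t | a t. a \<in> F \<and> t \<in> R.Span F ys}"
      unfolding R.line_extension_def set_add_def set_mult_def r_coset_def
      by (auto simp: ring_of_type_algebra_def simp del: R.Span.simps)
    also have "\<dots> \<subseteq> S"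
    proof -
      have "R.Span F ys \<subseteq> S" "y \<in> S"
        using Cons by simp_all
      then show ?thesis
        using that(1,3) by blast
    qed
    finally show ?case .
  qed
  then have "\<forall>S. F \<subseteq> S \<longrightarrow> set xs \<subseteq> S \<longrightarrow> (\<forall>x\<in>S. \<forall>y\<in>S. x + y \<in> S \<and> x * y \<in> S) \<longrightarrow> S = UNIV"
    using xs by (metis top.extremum_unique)
  then show ?thesis
    by blast
qed

lemma embedding_root:
  assumes \<sigma>: "\<sigma> \<in> embeddings F" and p: "p \<in> polys_over F"
  shows "\<sigma> (poly p x) = poly (map_poly to_ac p) (\<sigma> x)"
proof -
  have "\<sigma> (poly p x) = poly (map_poly \<sigma> p) (\<sigma> x)"
    using \<sigma> is_subfield_UNIV
    by (intro poly_map_poly_hom_on[of UNIV]) (auto simp: embeddings_def is_subfield_def polys_over_def)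
  also have "map_poly \<sigma> p = map_poly to_ac p"
  proof (rule map_poly_cong)
    fix a assume "a \<in> set (Polynomial.coeffs p)"
    then have "a \<in> range (Polynomial.coeff p)"
      by (simp add: range_coeff)
    then show "\<sigma> a = to_ac a"
      using \<sigma> p by (auto simp: embeddings_def polys_over_def)
  qed
  finally show ?thesis .
qed

text \<open>An embedding is determined by its values on a spanning list, and each value is a root of
  a fixed nonzero polynomial.\<close>

lemma finite_embeddings: "finite (embeddings F)"
proof -
  obtain xs where xs: "\<And>S. F \<subseteq> S \<Longrightarrow> set xs \<subseteq> S \<Longrightarrow> (\<forall>x\<in>S. \<forall>y\<in>S. x + y \<in> S \<and> x * y \<in> S) \<Longrightarrow> S = UNIV"
    using ext_finitely_generated by blast
  have "\<exists>p. p \<in> polys_over F \<and> p \<noteq> 0 \<and> poly p x = 0" for x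
    using ext_algebraic[of x] by (auto simp: algebraic_over_def)
  then obtain p where p: "\<And>x. p x \<in> polys_over F" "\<And>x. p x \<noteq> 0" "\<And>x. poly (p x) x = 0"
    by metis
  define Z where "Z = (\<Union>x\<in>set xs. {z. poly (map_poly to_ac (p x)) z = 0})"
  have "map_poly to_ac (p x) \<noteq> 0" for x
    using p(2)[of x] hom_on_eq_0_iff[OF hom_on_to_ac is_subfield_UNIV] by (subst map_poly_eq_0_iff) auto
  then have "finite Z"
    by (auto simp: Z_def intro: poly_roots_finite)
  have "(\<lambda>\<sigma>. map \<sigma> xs) ` embeddings F \<subseteq> {ys. set ys \<subseteq> Z \<and> length ys = length xs}"
  proof -
    have "\<sigma> x \<in> Z" if "\<sigma> \<in> embeddings F" "x \<in> set xs" for \<sigma> x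
    proof -
      have "poly (map_poly to_ac (p x)) (\<sigma> x) = \<sigma> 0"
        using embedding_root[OF that(1) p(1)[of x], of x] p(3) by simp
      also have "\<sigma> 0 = 0"
        using that(1) hom_onD(1)[of UNIV \<sigma>] is_subfield_UNIV by (auto simp: embeddings_def is_subfield_def)
      finally show ?thesis
        using that(2) by (auto simp: Z_def)
    qed
    then show ?thesis
      by auto
  qed
  then have "finite ((\<lambda>\<sigma>. map \<sigma> xs) ` embeddings F)"
    using finite_lists_length_eq[OF \<open>finite Z\<close>, of "length xs"] by (rule finite_subset)
  moreover have "inj_on (\<lambda>\<sigma>. map \<sigma> xs) (embeddings F)"
  proof (rule inj_onI)
    fix \<sigma> \<tau> assume *: "\<sigma> \<in> embeddings F" "\<tau> \<in> embeddings F" "map \<sigma> xs = map \<tau> xs"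
    have "{x. \<sigma> x = \<tau> x} = UNIV"
      using * by (intro xs) (auto simp: embeddings_def hom_on_def)
    then show "\<sigma> = \<tau>"
      by auto
  qed
  ultimately show ?thesis
    by (rule finite_imageD)
qed

lemma embedding_extends:
  assumes "is_subfield L" "F \<subseteq> L" "hom_on L \<sigma>" "\<And>a. a \<in> F \<Longrightarrow> \<sigma> a = to_ac a"
  shows "\<exists>\<tau>\<in>embeddings F. \<forall>y\<in>L. \<tau> y = \<sigma> y"
proof -
  obtain xs where xs: "\<And>S. F \<subseteq> S \<Longrightarrow> set xs \<subseteq> S \<Longrightarrow> (\<forall>x\<in>S. \<forall>y\<in>S. x + y \<in> S \<and> x * y \<in> S) \<Longrightarrow> S = UNIV"
    using ext_finitely_generated by blast
  obtain L' \<tau> where L': "is_subfield L'" "L \<subseteq> L'" "set xs \<subseteq> L'" "hom_on L' \<tau>" "\<forall>y\<in>L. \<tau> y = \<sigma> y"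
    using hom_on_extend_list[OF ext_is_subfield ext_algebraic assms(1-3)] by blast
  have "L' = UNIV"
    using L' assms(2) by (intro xs) (auto simp: is_subfield_def dest: unital_subringD)
  then show ?thesis
    using L' assms(2,4) by (intro bexI[of _ \<tau>]) (auto simp: embeddings_def)
qed

text \<open>The multiset consists of the roots of the minimal polynomial of \<open>x\<close>, and \<open>c\<close> is its constant
  coefficient up to sign.\<close>

lemma exists_norm:
  "\<exists>c\<in>F. \<exists>A. to_ac c = prod_mset A \<and> to_ac x \<in># A \<and> (\<forall>\<beta>\<in>#A. \<exists>\<sigma>\<in>embeddings F. \<sigma> x = \<beta>)"
proof -
  have F: "unital_subring F" "is_subfield F"
    using ext_is_subfield by (auto simp: is_subfield_def)
  note FD = unital_subringD[OF F(1)]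
  obtain q where q: "q \<in> polys_over F" "q \<noteq> 0" "poly q x = 0"
      "\<And>r. r \<in> polys_over F \<Longrightarrow> r \<noteq> 0 \<Longrightarrow> poly r x = 0 \<Longrightarrow> Polynomial.degree q \<le> Polynomial.degree r"
    using exists_min_poly[OF ext_algebraic] by blast
  define c where "c = inverse (Polynomial.lead_coeff q)"
  define p where "p = Polynomial.smult c q"
  have c: "c \<in> F" "c \<noteq> 0"
    using q(1,2) F(2) by (auto simp: c_def is_subfield_def polys_over_def)
  have p: "p \<in> polys_over F" "p \<noteq> 0" "poly p x = 0" "Polynomial.lead_coeff p = 1"
      "\<And>r. r \<in> polys_over F \<Longrightarrow> r \<noteq> 0 \<Longrightarrow> poly r x = 0 \<Longrightarrow> Polynomial.degree p \<le> Polynomial.degree r"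
    using q c FD by (auto simp: p_def polys_over_def) (auto simp: c_def)
  define P where "P = map_poly to_ac p"
  have deg: "Polynomial.degree P = Polynomial.degree p"
    unfolding P_def by (rule map_poly_degree_eq) (use p(4) in auto)
  have lead: "Polynomial.lead_coeff P = 1"
    unfolding deg using p(4) by (simp add: P_def coeff_map_poly)
  then have "P \<noteq> 0"
    by auto
  then obtain A where "P = Polynomial.smult (Polynomial.lead_coeff P) (\<Prod>\<beta>\<in>#A. [:- \<beta>, 1:])"
    using alg_closed_imp_factorization by blast
  then have A: "P = (\<Prod>\<beta>\<in>#A. [:- \<beta>, 1:])"
    by (simp add: lead)
  have roots: "poly P \<beta> = 0 \<longleftrightarrow> \<beta> \<in># A" for \<beta>
    by (auto simp: A poly_prod_mset prod_mset_zero_iff)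
  \<comment> \<open>The constant coefficient is the product of the negated roots; the sign is moved
    into \<open>c\<close>, which remains in \<open>F\<close>.\<close>
  have neg: "(\<Prod>\<beta>\<in>#B. - \<beta>) = (- 1) ^ size B * prod_mset B" for B :: "'a alg_closure multiset"
    by (induction B) auto
  have "to_ac (Polynomial.coeff p 0) = poly P 0"
    by (simp add: P_def coeff_map_poly poly_0_coeff_0)
  also have "\<dots> = (- 1) ^ size A * prod_mset A"
    by (simp add: A poly_prod_mset neg)
  finally have "to_ac ((- 1) ^ size A * Polynomial.coeff p 0) = prod_mset A"
    by (simp flip: power_mult_distrib mult.assoc)
  moreover have "(- 1) ^ size A * Polynomial.coeff p 0 \<in> F"
    using p(1) FD unital_subring_power[OF F(1), of "- 1"] by (simp add: polys_over_def)
  moreover have "to_ac x \<in># A"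
    using poly_map_poly_hom_on[OF hom_on_to_ac, of UNIV p x] p(3) is_subfield_UNIV
    by (simp add: polys_over_def is_subfield_def P_def flip: roots)
  \<comment> \<open>Every root of the minimal polynomial is a conjugate: \<open>x\<close> is sent to
    \<open>\<beta>\<close> on F[x], and this map extends to the whole field.\<close>
  moreover have "\<exists>\<sigma>\<in>embeddings F. \<sigma> x = \<beta>" if "\<beta> \<in># A" for \<beta>
  proof -
    have "poly (map_poly to_ac p) \<beta> = 0"
      using that by (simp add: P_def flip: roots)
    then obtain \<tau> where \<tau>: "hom_on (adjoin F x) \<tau>" "\<forall>y\<in>F. \<tau> y = to_ac y" "\<tau> x = \<beta>"
      using hom_on_adjoin[OF F(2) hom_on_to_ac p(1-3,5)] by blast
    have incl: "F \<subseteq> adjoin F x" "x \<in> adjoin F x"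
      using adjoin_incl adjoin_gen FD by blast+
    have "is_subfield (adjoin F x)"
      using is_subfield_of_algebraic[OF unital_subring_adjoin[OF F(1)] F(2) incl(1) ext_algebraic] .
    then show ?thesis
      using embedding_extends[OF _ incl(1) \<tau>(1)] \<tau> incl(2) by metis
  qed
  ultimately show ?thesis
    by blast
qed

lemma embeddings_nonempty: "embeddings F \<noteq> {}"
  using exists_norm[of 0] by blast

end


section \<open>Primes over a valuation ring of the base field\<close>

definition valring_of :: "'a::field set \<Rightarrow> 'a set \<Rightarrow> bool" where
  "valring_of F S \<longleftrightarrow> unital_subring S \<and> S \<subseteq> F \<and> (\<forall>x\<in>F. x \<in> S \<or> inverse x \<in> S)"

lemma hom_UNIV:
  assumes "hom_on UNIV \<sigma>"
  shows "\<sigma> 0 = 0" "\<sigma> 1 = 1" "\<sigma> (x + y) = \<sigma> x + \<sigma> y" "\<sigma> (x * y) = \<sigma> x * \<sigma> y" "\<sigma> (- x) = - \<sigma> x"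
    "\<sigma> (inverse x) = inverse (\<sigma> x)" "\<sigma> x = 0 \<longleftrightarrow> x = 0"
  using hom_onD[OF assms] hom_on_inverse[OF assms is_subfield_UNIV]
    hom_on_eq_0_iff[OF assms is_subfield_UNIV] is_subfield_UNIV
  by (simp_all add: is_subfield_def)

lemma valring_vimage: "hom_on UNIV \<sigma> \<Longrightarrow> valring W \<Longrightarrow> valring (\<sigma> -` W)"
  by (auto simp: valring_def unital_subring_def hom_UNIV)

lemma nonunits_vimage: "hom_on UNIV \<sigma> \<Longrightarrow> nonunits (\<sigma> -` W) = \<sigma> -` nonunits W"
  by (auto simp: nonunits_def hom_UNIV)

lemma exists_valring_image_centre:
  assumes \<sigma>: "hom_on UNIV \<sigma>" and B: "unital_subring B" "prime_in B P"
  shows "\<exists>W. valring W \<and> \<sigma> ` B \<subseteq> W \<and> (\<forall>x\<in>B. \<sigma> x \<in> nonunits W \<longleftrightarrow> x \<in> P)"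
proof -
  note hom = hom_UNIV[OF \<sigma>]
  have inj: "\<sigma> x = \<sigma> y \<longleftrightarrow> x = y" for x y
    using hom(3)[of x "- y"] hom(5)[of y] hom(7)[of "x + - y"] by auto
  have "unital_subring (\<sigma> ` B)"
    unfolding unital_subring_def using unital_subringD[OF B(1)]
    by (auto simp: image_iff simp flip: hom(3,4,5)) (metis hom(1,2))+
  moreover have "prime_in (\<sigma> ` B) (\<sigma> ` P)"
  proof -
    have mem: "\<sigma> x \<in> \<sigma> ` P \<longleftrightarrow> x \<in> P" for x
      by (auto simp: inj image_iff)
    have "0 \<in> \<sigma> ` P" "1 \<notin> \<sigma> ` P"
      using mem[of 0] mem[of 1] prime_inD(2,3)[OF B(2)] hom(1,2) by auto
    then show ?thesis
      using prime_inD[OF B(2)]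
      by (auto simp: prime_in_def mem simp flip: hom(3,4))
  qed
  ultimately obtain W where "valring W" "\<sigma> ` B \<subseteq> W" "nonunits W \<inter> \<sigma> ` B = \<sigma> ` P"
    using exists_valring_centre by blast
  then show ?thesis
    by (intro exI[of _ W] conjI ballI) (simp_all add: inj set_eq_iff image_iff, metis inj)
qed

text \<open>Multiply elements chosen from each \<open>r\<close> outside \<open>p\<close>; the
  product stays outside because \<open>p\<close> is prime.\<close>

lemma exists_common_element:
  assumes N: "unital_subring N" and p: "prime_in N p"
    and S: "finite S" "\<And>r. r \<in> S \<Longrightarrow> prime_in N r" "\<And>r. r \<in> S \<Longrightarrow> \<not> r \<subseteq> p"
  shows "\<exists>t\<in>N - p. \<forall>r\<in>S. t \<in> r"
  using S
proof (induction S)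
  case empty
  then show ?case
    using unital_subringD(2)[OF N] prime_inD(3)[OF p] by blast
next
  case (insert r S)
  then obtain t where t: "t \<in> N - p" "\<forall>r\<in>S. t \<in> r"
    by auto
  obtain s where s: "s \<in> r" "s \<notin> p"
    using insert.prems(2)[of r] by blast
  have "s \<in> N"
    using s(1) prime_inD(1)[OF insert.prems(1)[of r]] by blast
  have "s * t \<in> r'" if "r' \<in> insert r S" for r'
  proof (cases "r' = r")
    case True
    then show ?thesis
      using prime_inD(5)[OF insert.prems(1)[of r], of t s] s(1) t(1) by (simp add: mult.commute)
  next
    case False
    then show ?thesis
      using prime_inD(5)[OF insert.prems(1)[OF that] \<open>s \<in> N\<close>, of t] that t(2) by blast
  qed
  moreover have "s * t \<in> N - p"
    using unital_subringD(6)[OF N \<open>s \<in> N\<close>, of t] prime_inD(6)[OF p \<open>s \<in> N\<close>, of t] s(2) t(1) by blast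
  ultimately show ?case
    by blast
qed

text \<open>Induction on the set of primes to be avoided. If the element found so far falls into the
  new prime \<open>p\<close>, it is corrected by some \<open>t\<close> lying in \<open>q\<close> and
  in all earlier primes but not in \<open>p\<close>; incomparability provides
  \<open>t\<close>.\<close>

lemma prime_avoidance:
  assumes N: "unital_subring N" and q: "prime_in N q"
    and S: "finite S" "\<And>r. r \<in> S \<Longrightarrow> prime_in N r" "\<And>r. r \<in> S \<Longrightarrow> \<not> q \<subseteq> r"
    and "\<And>r s. r \<in> S \<Longrightarrow> s \<in> S \<Longrightarrow> r \<subseteq> s \<Longrightarrow> r = s"
  shows "\<exists>x\<in>q. \<forall>r\<in>S. x \<notin> r"
  using S assms(6)
proof (induction S)
  case empty
  then show ?case
    using prime_inD(2)[OF q] by blast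
next
  case (insert p S)
  have "\<exists>x\<in>q. \<forall>r\<in>S. x \<notin> r"
  proof (rule insert.IH)
    show "prime_in N r" "\<not> q \<subseteq> r" if "r \<in> S" for r
      using that insert.prems(1,2) by simp_all
    show "r = s" if "r \<in> S" "s \<in> S" "r \<subseteq> s" for r s
      using that insert.prems(3) by simp
  qed
  then obtain x where x: "x \<in> q" "\<forall>r\<in>S. x \<notin> r"
    by blast
  show ?case
  proof (cases "x \<in> p")
    case True
    have "\<exists>t\<in>N - p. \<forall>r\<in>insert q S. t \<in> r"
    proof (rule exists_common_element[OF N])
      show "\<not> r \<subseteq> p" if "r \<in> insert q S" for r
        using that insert.prems(2,3) insert.hyps(2) by blast
      show "prime_in N r" if "r \<in> insert q S" for r
        using that insert.prems(1) q by auto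
    qed (use insert.prems(1) insert.hyps(1) in simp_all)
    then obtain t where t: "t \<in> N" "t \<notin> p" "t \<in> q" "\<And>r. r \<in> S \<Longrightarrow> t \<in> r"
      by blast
    \<comment> \<open>In each prime of \<open>insert p S\<close> exactly one of \<open>x\<close> and
      \<open>t\<close> lies, so their sum avoids all of them.\<close>
    have diff: "a + b \<notin> r" if "prime_in N r" "a \<in> r" "b \<notin> r" for a b r
      using prime_inD(4)[OF that(1), of "a + b" "- a"] prime_in_uminus[OF N that(1,2)] that(3) by auto
    have "x + t \<notin> r" if "r \<in> insert p S" for r
      using diff[of r x t] diff[of r t x] that insert.prems(1) True t x(2) by (auto simp: add.commute)
    then show ?thesis
      using prime_inD(4)[OF q x(1) t(3)] by blast
  next
    case False
    then show ?thesis
      using x by blast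
  qed
qed

text \<open>Given elements witnessing both non-inclusions, one of their two quotients is in
  \<open>S\<close>, which forces an element into the prime it was chosen to avoid.\<close>

lemma valring_of_prime_total:
  assumes S: "valring_of F S" "is_subfield F" and P: "prime_in S P" "prime_in S Q"
  shows "P \<subseteq> Q \<or> Q \<subseteq> P"
proof (rule ccontr)
  assume "\<not> ?thesis"
  then obtain x y where xy: "x \<in> P" "x \<notin> Q" "y \<in> Q" "y \<notin> P"
    by blast
  then have nz: "x \<noteq> 0" "y \<noteq> 0"
    using P prime_inD(2) by auto
  have "x \<in> F" "y \<in> F"
    using xy prime_inD(1)[OF P(1)] prime_inD(1)[OF P(2)] S(1) by (auto simp: valring_of_def)
  then have "x * inverse y \<in> F"
    using S(2) by (auto simp: is_subfield_def intro: unital_subringD)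
  then have "x * inverse y \<in> S \<or> inverse (x * inverse y) \<in> S"
    using S(1) by (auto simp: valring_of_def)
  then show False
  proof
    assume "x * inverse y \<in> S"
    then have "x * inverse y * y \<in> Q"
      using prime_inD(5)[OF P(2) _ xy(3)] by blast
    then show False
      using nz xy(2) by (simp add: mult.assoc)
  next
    assume "inverse (x * inverse y) \<in> S"
    then have "inverse (x * inverse y) * x \<in> P"
      using prime_inD(5)[OF P(1) _ xy(1)] by blast
    then show False
      using nz xy(4) by (simp add: field_simps)
  qed
qed

text \<open>An element of \<open>F\<close> outside \<open>S\<close> has its inverse in
  \<open>S\<close>, so some valuation ring over \<open>R\<close> avoids it. For \<open>R = S\<close>
  this is the integral closedness of \<open>S\<close> in \<open>F\<close>.\<close>

lemma integral_closure_Int_valring_of: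
  assumes S: "valring_of F S" and R: "unital_subring R" "R \<inter> F = S"
  shows "integral_closure R \<inter> F = S"
proof
  show "integral_closure R \<inter> F \<subseteq> S"
  proof
    fix x assume x: "x \<in> integral_closure R \<inter> F"
    show "x \<in> S"
    proof (rule ccontr)
      assume "x \<notin> S"
      then have "x \<notin> R" "inverse x \<in> R"
        using x S R(2) by (auto simp: valring_of_def)
      then obtain V where "valring V" "R \<subseteq> V" "x \<notin> V"
        using exists_valring_avoiding[OF R(1)] by blast
      then show False
        using x by (auto simp: integral_closure_eq_Inter_valring[OF R(1)])
    qed
  qed
  show "S \<subseteq> integral_closure R \<inter> F"
    using R(2) integral_closure_incl[OF R(1)] by blast
qed

lemma exists_prime_over_valring_of:
  assumes S: "valring_of F S" "is_subfield F" and R: "unital_subring R" "R \<inter> F = S" and P: "prime_in S P"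
  shows "\<exists>Q. prime_in R Q \<and> Q \<inter> S = P"
proof -
  note PD = prime_inD[OF P]
  note RD = unital_subringD[OF R(1)]
  have S': "unital_subring S" "S \<subseteq> F" "S \<subseteq> R"
    using S R by (auto simp: valring_of_def)
  \<comment> \<open>If \<open>p'\<close> divides \<open>p\<close> in \<open>S\<close>, it can be
    factored out of the sum; so sums of products collapse to single products.\<close>
  have add: "p * a + p' * a' \<in> {p * r | p r. p \<in> P \<and> r \<in> R}"
    if "p \<in> P" "p' \<in> P" "a \<in> R" "a' \<in> R" "p * inverse p' \<in> S" "p' \<noteq> 0" for p p' a a'
  proof -
    have "p * a + p' * a' = p' * ((p * inverse p') * a + a')"
      using that by (simp add: field_simps)
    moreover have "(p * inverse p') * a + a' \<in> R"
      using that S'(3) RD(4)[OF RD(6)] by blast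
    ultimately show ?thesis
      using that by blast
  qed
  have "gen_ideal P R \<subseteq> {p * r | p r. p \<in> P \<and> r \<in> R}"
  proof (rule gen_ideal_least, goal_cases)
    case 1
    then show ?case
      using PD(2) RD(1) by force
  next
    case (2 x y)
    then obtain p p' a a' where *: "p \<in> P" "p' \<in> P" "a \<in> R" "a' \<in> R" "x = p * a" "y = p' * a'"
      by blast
    show ?case
    proof (cases "p = 0 \<or> p' = 0")
      case True
      then show ?thesis
        using * by (elim disjE) (simp_all, blast+)
    next
      case False
      have "p \<in> F" "p' \<in> F"
        using * PD(1) S'(2) by blast+
      then have "p * inverse p' \<in> F"
        using S(2) by (auto simp: is_subfield_def intro: unital_subringD)
      then have "p * inverse p' \<in> S \<or> p' * inverse p \<in> S"
        using S(1) unfolding valring_of_def by (metis inverse_inverse_eq inverse_mult_distrib mult.commute)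
      then show ?thesis
        using add[OF *(1-4)] add[OF *(2,1,4,3)] False *(5,6) by (auto simp: add.commute)
    qed
  next
    case (3 p a)
    then show ?case
      by blast
  qed
  \<comment> \<open>For nonzero \<open>p\<close> the factor \<open>r\<close> is a quotient of
    elements of \<open>F\<close>, hence lies in \<open>R \<inter> F = S\<close>.\<close>
  moreover have "p * r \<in> P" if "p \<in> P" "r \<in> R" "p * r \<in> S" for p r
  proof (cases "p = 0")
    case True
    then show ?thesis
      using PD(2) by simp
  next
    case False
    have "p \<in> F" "p * r \<in> F"
      using that PD(1) S'(2) by blast+
    then have "inverse p * (p * r) \<in> F"
      using S(2) by (auto simp: is_subfield_def intro!: unital_subringD)
    then have "r \<in> S"
      using False that(2) R(2) by (auto simp flip: mult.assoc)
    then show ?thesis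
      using PD(5)[of r p] that(1) by (simp add: mult.commute)
  qed
  ultimately have "gen_ideal P R \<inter> S \<subseteq> P"
    by blast
  then obtain V where V: "valring V" "R \<subseteq> V" "nonunits V \<inter> S = P"
    using exists_valring_lying_over[OF S'(1) R(1) S'(3) P] by blast
  then show ?thesis
    using prime_in_Int[OF prime_in_nonunits R(1)] S'(3) by (intro exI[of _ "nonunits V \<inter> R"]) auto
qed

text \<open>A valuation ring with centre \<open>P\<close> on \<open>R\<close> contains the integral
  closure, and its centre there lies over \<open>P\<close>.\<close>

lemma exists_prime_over_integral_closure:
  assumes R: "unital_subring R" "prime_in R P"
  shows "\<exists>Q. prime_in (integral_closure R) Q \<and> Q \<inter> R = P"
proof -
  obtain V where V: "valring V" "R \<subseteq> V" "nonunits V \<inter> R = P"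
    using exists_valring_centre[OF R] by blast
  then have "integral_closure R \<subseteq> V"
    by (auto simp: integral_closure_eq_Inter_valring[OF R(1)])
  then show ?thesis
    using V integral_closure_incl[OF R(1)]
      prime_in_Int[OF prime_in_nonunits[OF V(1)] unital_subring_integral_closure[OF R(1)]]
    by (intro exI[of _ "nonunits V \<inter> integral_closure R"]) auto
qed

section \<open>Primitive equations, incomparability and the Pruefer property\<close>

lemma valring_of_max:
  assumes S: "valring_of F S" "is_subfield F" and T: "finite T" "T \<noteq> {}" "T \<subseteq> F - {0}"
  shows "\<exists>t\<in>T. \<forall>s\<in>T. s * inverse t \<in> S"
  using T
proof (induction T rule: finite_ne_induct)
  case (singleton t)
  then show ?case
    using S(1) by (auto simp: valring_of_def dest: unital_subringD)
next
  case (insert u T)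
  note SD = S(1)[unfolded valring_of_def, THEN conjunct1, THEN unital_subringD(2)]
    S(1)[unfolded valring_of_def, THEN conjunct1, THEN unital_subringD(6)]
  \<comment> \<open>In terms of values \<open>t\<close> is an element of least value in
    \<open>T\<close>; it is kept or replaced by \<open>u\<close>, according to which quotient is in
    \<open>S\<close>.\<close>
  obtain t where t: "t \<in> T" "\<forall>s\<in>T. s * inverse t \<in> S"
    using insert by auto
  have nz: "t \<noteq> 0" "u \<noteq> 0" "t \<in> F" "u \<in> F"
    using insert.prems t(1) by auto
  then have "u * inverse t \<in> F"
    using S(2) by (auto simp: is_subfield_def intro: unital_subringD)
  then consider "u * inverse t \<in> S" | "t * inverse u \<in> S"
    using S(1) unfolding valring_of_def by (metis inverse_inverse_eq inverse_mult_distrib mult.commute)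
  then show ?case
  proof cases
    case 1
    then show ?thesis
      using t by blast
  next
    case 2
    have "s * inverse u \<in> S" if "s \<in> T" for s
      using SD(2)[OF t(2)[rule_format, OF that] 2] nz by (simp add: field_simps)
    moreover have "u * inverse u \<in> S"
      using nz SD(1) by simp
    ultimately show ?thesis
      by blast
  qed
qed

text \<open>An annihilating polynomial over \<open>F\<close> is divided by a coefficient of least
  value: all coefficients move into \<open>S\<close> and one of them becomes 1.\<close>

lemma exists_primitive_poly:
  assumes S: "valring_of F S" "is_subfield F" and x: "algebraic_over F x"
  shows "\<exists>f\<in>polys_over S. poly f x = 0 \<and> (\<exists>i. Polynomial.coeff f i = 1)"
proof -
  obtain p where p: "p \<in> polys_over F" "p \<noteq> 0" "poly p x = 0"
    using x by (auto simp: algebraic_over_def)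
  have rg: "range (Polynomial.coeff p) = insert 0 (set (Polynomial.coeffs p))"
    by (simp add: range_coeff)
  have sub: "set (Polynomial.coeffs p) - {0} \<subseteq> F - {0}"
  proof
    fix a assume "a \<in> set (Polynomial.coeffs p) - {0}"
    then have "a \<in> range (Polynomial.coeff p)" "a \<noteq> 0"
      using rg by auto
    then show "a \<in> F - {0}"
      using p(1) by (auto simp: polys_over_def)
  qed
  have "Polynomial.lead_coeff p \<in> set (Polynomial.coeffs p) - {0}"
    using p(2) by (simp add: coeff_in_coeffs)
  then obtain t where t: "t \<in> set (Polynomial.coeffs p) - {0}"
      "\<forall>s\<in>set (Polynomial.coeffs p) - {0}. s * inverse t \<in> S"
    using valring_of_max[OF S _ _ sub] by blast
  have S0: "0 \<in> S"
    using S(1) by (auto simp: valring_of_def dest: unital_subringD)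
  obtain i where i: "t = Polynomial.coeff p i"
    using t(1) rg by blast
  have "Polynomial.coeff p j * inverse t \<in> S" for j
    using t(2) rg S0 by (cases "Polynomial.coeff p j = 0") (simp, blast)
  then have "Polynomial.smult (inverse t) p \<in> polys_over S"
    by (simp add: polys_over_def mult.commute)
  moreover have "Polynomial.coeff (Polynomial.smult (inverse t) p) i = 1"
    using t(1) i by simp
  ultimately show ?thesis
    using p(3) by (intro bexI[of _ "Polynomial.smult (inverse t) p"]) auto
qed

text \<open>For \<open>y\<close> in \<open>q'\<close>, a primitive equation is stripped from its
  constant term \<open>a\<close> upwards. While \<open>a\<close> is in \<open>q\<close>, primality
  gives \<open>y \<in> q\<close> or a shorter relation modulo \<open>q\<close>; an \<open>a\<close>
  outside \<open>q\<close> would lie in \<open>q'\<close>, contradicting the equal traces on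
  \<open>S\<close>.\<close>

lemma prime_over_incomparable:
  assumes S: "valring_of F S" "is_subfield F" "\<And>x. algebraic_over F x"
    and N: "unital_subring N" "S \<subseteq> N" and q: "prime_in N q" "prime_in N q'" "q \<subseteq> q'"
    and P: "q \<inter> S = q' \<inter> S"
  shows "q = q'"
proof
  show "q' \<subseteq> q"
  proof
    fix y assume y: "y \<in> q'"
    note qD = prime_inD[OF q(1)] and q'D = prime_inD[OF q(2)]
    have "unital_subring S"
      using S(1) by (simp add: valring_of_def)
    note SD = unital_subringD[OF this]
    have yN: "y \<in> N"
      using y q'D(1) by blast
    have key: "y \<in> q" if "f \<in> polys_over S" "\<exists>i. Polynomial.coeff f i \<notin> q" "poly f y \<in> q" for f
      using that
    proof (induction f)
      case 0
      then show ?case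
        using qD(2) by simp
    next
      case (pCons a f)
      have af: "a \<in> S" "f \<in> polys_over S"
        using pCons.prems(1) polys_over_pCons SD(1) by blast+
      have fN: "poly f y \<in> N"
        using poly_in_subring[OF N(1) polys_over_mono[OF af(2) N(2)] yN] .
      have eq: "a + y * poly f y \<in> q"
        using pCons.prems(3) by simp
      show ?case
      proof (cases "a \<in> q")
        case True
        then have "- a + (a + y * poly f y) \<in> q"
          using eq prime_in_uminus[OF N(1) q(1)] qD(4) by blast
        then have "y \<in> q \<or> poly f y \<in> q"
          using qD(6)[OF yN fN] by simp
        moreover have "\<exists>i. Polynomial.coeff f i \<notin> q"
          using pCons.prems(2) True by (metis coeff_pCons_0 coeff_pCons_Suc not0_implies_Suc)
        ultimately show ?thesis
          using pCons.IH af(2) by blast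
      next
        case False
        have "poly f y * y \<in> q'"
          using q'D(5)[OF fN y] .
        then have "(a + y * poly f y) + - (poly f y * y) \<in> q'"
          using eq q(3) prime_in_uminus[OF N(1) q(2)] q'D(4) by blast
        then have "a \<in> q'"
          by simp
        then show ?thesis
          using False af(1) P by blast
      qed
    qed
    obtain f i where "f \<in> polys_over S" "poly f y = 0" "Polynomial.coeff f i = 1"
      using exists_primitive_poly[OF S(1,2,3)] by blast
    then show "y \<in> q"
      using key[of f] qD(2,3) by (metis)
  qed
qed (rule q(3))

text \<open>The elements \<open>b k\<close> are the partial Horner sums of a primitive equation for \<open>x\<close>.\<close>

lemma exists_denominator:
  assumes S: "valring_of F S" "is_subfield F" "algebraic_over F x" and q: "prime_in (integral_closure S) q"
  shows "\<exists>b\<in>integral_closure S. b * x \<in> integral_closure S \<and> (b \<notin> q \<or> b * x \<notin> q)"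
proof -
  define N where "N = integral_closure S"
  have S': "unital_subring S"
    using S(1) by (simp add: valring_of_def)
  have N: "unital_subring N" "S \<subseteq> N" "N = \<Inter>{V. valring V \<and> S \<subseteq> V}"
    using unital_subring_integral_closure[OF S'] integral_closure_incl[OF S']
      integral_closure_eq_Inter_valring[OF S'] by (auto simp: N_def)
  note ND = unital_subringD[OF N(1)] and qD = prime_inD[OF q, folded N_def]
  obtain f j where f: "f \<in> polys_over S" "poly f x = 0" "Polynomial.coeff f j = 1"
    using exists_primitive_poly[OF S] by blast
  define b where "b k = poly (poly_shift k f) x" for k
  have b0: "b 0 = 0"
    using f(2) by (simp add: b_def)
  have step: "b k = Polynomial.coeff f k + x * b (Suc k)" for k
  proof -
    have "poly_shift k f = pCons (Polynomial.coeff f k) (poly_shift (Suc k) f)"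
      by (rule poly_eqI) (auto simp: coeff_pCons coeff_poly_shift split: nat.splits)
    then show ?thesis
      by (simp add: b_def)
  qed
  \<comment> \<open>Integrality is tested in each valuation ring \<open>V\<close> over
    \<open>S\<close>. If \<open>x\<close> is in \<open>V\<close>, then \<open>b k\<close> is a
    polynomial in \<open>x\<close>; otherwise the recursion \<open>step\<close>, solved for
    \<open>b (Suc k)\<close>, starts from \<open>b 0 = 0\<close> and only needs
    \<open>inverse x\<close>.\<close>
  have bN: "b k \<in> N" for k
    unfolding N(3)
  proof safe
    fix V assume V: "valring V" "S \<subseteq> V"
    then have V': "unital_subring V" "x \<in> V \<or> inverse x \<in> V"
      by (auto simp: valring_def)
    note VD = unital_subringD[OF V'(1)]
    have aV: "Polynomial.coeff f i \<in> V" for i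
      using f(1) V(2) by (auto simp: polys_over_def)
    show "b k \<in> V"
    proof (cases "x \<in> V")
      case True
      then show ?thesis
        unfolding b_def
        by (intro poly_in_subring[OF V'(1)]) (auto simp: polys_over_def coeff_poly_shift aV)
    next
      case False
      then have ix: "inverse x \<in> V" "x \<noteq> 0"
        using V'(2) VD(1) by auto
      show ?thesis
      proof (induction k)
        case (Suc k)
        have "b (Suc k) = (b k - Polynomial.coeff f k) * inverse x"
          using step[of k] ix(2) by simp
        then show ?case
          using Suc aV ix(1) VD(5,6) by simp
      qed (use b0 VD(1) in simp)
    qed
  qed
  have xbN: "b (Suc k) * x \<in> N" for k
  proof -
    have "b (Suc k) * x = b k - Polynomial.coeff f k"
      using step[of k] by simp
    moreover have "Polynomial.coeff f k \<in> N"
      using f(1) N(2) by (auto simp: polys_over_def)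
    ultimately show ?thesis
      using ND(5) bN by simp
  qed
  \<comment> \<open>At the coefficient 1 two consecutive sums combine to 1, so \<open>b j\<close>
    and \<open>b (Suc j) * x\<close> cannot both be in \<open>q\<close>. The denominator is
    \<open>b j\<close> or \<open>b (Suc j)\<close> accordingly; in the former case \<open>j\<close>
    is positive because \<open>b 0 = 0\<close>.\<close>
  have "b j - b (Suc j) * x = 1"
    using step[of j] f(3) by simp
  then have "b j + (- 1) * (b (Suc j) * x) \<notin> q"
    using qD(3) by simp
  then have "b j \<notin> q \<or> b (Suc j) * x \<notin> q"
    using qD(4) qD(5)[of "- 1"] ND(2,3) by blast
  then show ?thesis
  proof
    assume "b (Suc j) * x \<notin> q"
    then show ?thesis
      using bN xbN by (auto simp: N_def)
  next
    assume bj: "b j \<notin> q"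
    then obtain k where "j = Suc k"
      using b0 qD(2) by (cases j) auto
    then show ?thesis
      using bj bN[of j] xbN[of k] unfolding N_def by blast
  qed
qed

text \<open>For \<open>x\<close> in \<open>Q\<close> the denominator \<open>b\<close> satisfies
  \<open>b * x \<in> Q\<close>, so \<open>b\<close> is outside \<open>Q\<close>. Equal traces carry
  both facts over to \<open>Q'\<close>, and primality of \<open>Q'\<close> gives
  \<open>x \<in> Q'\<close>.\<close>

lemma prime_overring_unique:
  assumes S: "valring_of F S" "is_subfield F" "\<And>x. algebraic_over F x"
    and I: "integral_closure S \<subseteq> I" "unital_subring I"
    and Q: "prime_in I Q" "prime_in I Q'" "Q \<inter> integral_closure S = Q' \<inter> integral_closure S"
  shows "Q = Q'"
proof -
  have S': "unital_subring S"
    using S(1) by (simp add: valring_of_def)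
  have sub: "Q \<subseteq> Q'" if Q: "prime_in I Q" "prime_in I Q'"
      and eq: "Q \<inter> integral_closure S = Q' \<inter> integral_closure S" for Q Q'
  proof
    fix x assume x: "x \<in> Q"
    have "prime_in (integral_closure S) (Q \<inter> integral_closure S)"
      using prime_in_Int[OF Q(1) unital_subring_integral_closure[OF S'] I(1)] .
    then obtain b where b: "b \<in> integral_closure S" "b * x \<in> integral_closure S"
        "b \<notin> Q \<inter> integral_closure S \<or> b * x \<notin> Q \<inter> integral_closure S"
      using exists_denominator[OF S(1,2,3)] by blast
    have "b * x \<in> Q"
      using prime_inD(5)[OF Q(1) _ x] b(1) I(1) by blast
    then have "b \<notin> Q'" "b * x \<in> Q'"
      using b eq by blast+
    then show "x \<in> Q'"
      using prime_inD(6)[OF Q(2), of b x] b(1) I(1) x prime_inD(1)[OF Q(1)] by blast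
  qed
  show ?thesis
    using sub[OF Q] sub[OF Q(2,1) Q(3)[symmetric]] by blast
qed


section \<open>Conjugacy of the primes over a given prime\<close>

context
  fixes F S P :: "'a::field set" and W :: "'a alg_closure set"
  assumes fin: "finite_field_extension F" and S: "valring_of F S" and P: "prime_in S P"
    and W: "valring W" "to_ac ` S \<subseteq> W" "\<And>x. x \<in> S \<Longrightarrow> to_ac x \<in> nonunits W \<longleftrightarrow> x \<in> P"
begin

private lemma S_subring: "unital_subring S" and S_sub: "S \<subseteq> F"
  using S by (auto simp: valring_of_def)

private lemma embedding_hom: "\<sigma> \<in> embeddings F \<Longrightarrow> hom_on UNIV \<sigma>"
  by (simp add: embeddings_def)

text \<open>An embedding agrees with \<open>to_ac\<close> on \<open>S\<close>, so the preimage of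
  \<open>U\<close> is a valuation ring over \<open>S\<close> and contains the integral
  closure.\<close>

private lemma integral_closure_embedding:
  assumes "\<sigma> \<in> embeddings F" "valring U" "to_ac ` S \<subseteq> U" "x \<in> integral_closure S"
  shows "\<sigma> x \<in> U"
proof -
  have "S \<subseteq> \<sigma> -` U"
    using assms(1,3) S_sub by (auto simp: embeddings_def)
  moreover have "valring (\<sigma> -` U)"
    using valring_vimage[OF embedding_hom[OF assms(1)] assms(2)] .
  ultimately show ?thesis
    using assms(4) by (auto simp: integral_closure_eq_Inter_valring[OF S_subring])
qed

private lemma conjugate_prime:
  assumes "\<sigma> \<in> embeddings F"
  shows "prime_in (integral_closure S) (\<sigma> -` nonunits W \<inter> integral_closure S)"
    "\<sigma> -` nonunits W \<inter> integral_closure S \<inter> S = P"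
proof -
  have "integral_closure S \<subseteq> \<sigma> -` W"
    using integral_closure_embedding[OF assms W(1,2)] by blast
  then show "prime_in (integral_closure S) (\<sigma> -` nonunits W \<inter> integral_closure S)"
    using prime_in_Int[OF prime_in_nonunits[OF valring_vimage[OF embedding_hom[OF assms] W(1)]]
        unital_subring_integral_closure[OF S_subring]]
    by (simp add: nonunits_vimage[OF embedding_hom[OF assms]])
  show "\<sigma> -` nonunits W \<inter> integral_closure S \<inter> S = P"
    using assms W(3) S_sub integral_closure_incl[OF S_subring] prime_inD(1)[OF P]
    by (auto simp: embeddings_def subset_eq)
qed

text \<open>Here \<open>c\<close> is a product of conjugates of the integral \<open>x\<close>, so it
  is integral and, being in \<open>F\<close>, lies in \<open>S\<close>. In a valuation ring over a
  centre \<open>q\<close> the factor \<open>x\<close> is a nonunit and the cofactor is integral, so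
  the product is a nonunit too.\<close>

private lemma norm_in_prime:
  assumes q: "prime_in (integral_closure S) q" and x: "x \<in> q"
    and c: "c \<in> F" "to_ac c = prod_mset A" "to_ac x \<in># A" "\<And>\<beta>. \<beta> \<in># A \<Longrightarrow> \<exists>\<sigma>\<in>embeddings F. \<sigma> x = \<beta>"
  shows "c \<in> q \<inter> S"
proof -
  define N where "N = integral_closure S"
  have N: "unital_subring N" "S \<subseteq> N" "N = \<Inter>{V. valring V \<and> S \<subseteq> V}"
    using unital_subring_integral_closure[OF S_subring] integral_closure_incl[OF S_subring]
      integral_closure_eq_Inter_valring[OF S_subring] by (auto simp: N_def)
  have xN: "x \<in> N"
    using x prime_inD(1)[OF q] by (auto simp: N_def)
  have A: "\<beta> \<in> U" if "valring U" "to_ac ` S \<subseteq> U" "\<beta> \<in># A" for \<beta> U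
    using c(4)[OF that(3)] integral_closure_embedding[OF _ that(1,2)] xN by (auto simp: N_def)
  have "c \<in> N"
    unfolding N(3)
  proof safe
    fix V assume V: "valring V" "S \<subseteq> V"
    \<comment> \<open>The conjugates live only in the algebraic closure, so membership in
      \<open>V\<close> is tested in a valuation ring \<open>U\<close> there whose nonunits restrict
      to those of \<open>V\<close>.\<close>
    obtain U where U: "valring U" "to_ac ` V \<subseteq> U" "\<And>x. x \<in> V \<Longrightarrow> to_ac x \<in> nonunits U \<longleftrightarrow> x \<in> nonunits V"
      using exists_valring_image_centre[OF hom_on_to_ac _ prime_in_nonunits[OF V(1)]] V(1)
      by (auto simp: valring_def)
    have "to_ac c \<in> U"
      unfolding c(2) using A[OF U(1)] U(1,2) V(2)
      by (intro unital_subring_prod_mset) (auto simp: valring_def)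
    show "c \<in> V"
    proof (rule ccontr)
      assume "c \<notin> V"
      then have "c \<noteq> 0" "inverse c \<in> V" "inverse c \<in> nonunits V"
        using V(1) by (auto simp: valring_def nonunits_def dest: unital_subringD)
      then have "to_ac (inverse c) \<in> nonunits U" "to_ac c \<noteq> 0"
        using U(3) hom_UNIV(7)[OF hom_on_to_ac] by blast+
      then show False
        using \<open>to_ac c \<in> U\<close> by (simp add: nonunits_def)
    qed
  qed
  then have "c \<in> S"
    using c(1) integral_closure_Int_valring_of[OF S S_subring] S_sub by (auto simp: N_def)
  obtain V where V: "valring V" "N \<subseteq> V" "nonunits V \<inter> N = q"
    using exists_valring_centre[OF N(1)] q by (auto simp: N_def)
  obtain U where U: "valring U" "to_ac ` V \<subseteq> U" "\<And>x. x \<in> V \<Longrightarrow> to_ac x \<in> nonunits U \<longleftrightarrow> x \<in> nonunits V"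
    using exists_valring_image_centre[OF hom_on_to_ac _ prime_in_nonunits[OF V(1)]] V(1)
    by (auto simp: valring_def)
  have U': "unital_subring U"
    using U(1) by (simp add: valring_def)
  have "to_ac x \<in> nonunits U"
    using U(3) x V(2,3) xN by blast
  moreover obtain A' where A': "A = add_mset (to_ac x) A'"
    using c(3) by (meson mset_add)
  moreover have "prod_mset A' \<in> U"
  proof (rule unital_subring_prod_mset[OF U'])
    show "\<beta> \<in> U" if "\<beta> \<in># A'" for \<beta>
      using that A' U(2) V(2) N(2) by (intro A[OF U(1)]) auto
  qed
  ultimately have "to_ac c \<in> nonunits U"
    using prime_inD(5)[OF prime_in_nonunits[OF U(1)], of "prod_mset A'" "to_ac x"]
    by (simp add: c(2) mult.commute)
  then have "c \<in> q"
    using U(3)[of c] \<open>c \<in> N\<close> V(2,3) by blast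
  then show ?thesis
    using \<open>c \<in> S\<close> by blast
qed

theorem prime_over_conjugate:
  assumes q: "prime_in (integral_closure S) q" "q \<inter> S = P"
  shows "\<exists>\<sigma>\<in>embeddings F. q = \<sigma> -` nonunits W \<inter> integral_closure S"
proof (rule ccontr)
  assume contra: "\<not> ?thesis"
  define N where "N = integral_closure S"
  define C where "C \<sigma> = \<sigma> -` nonunits W \<inter> N" for \<sigma>
  have neq: "q \<noteq> C \<sigma>" if "\<sigma> \<in> embeddings F" for \<sigma>
    using contra that by (auto simp: C_def N_def)
  have N: "unital_subring N" "S \<subseteq> N"
    using unital_subring_integral_closure[OF S_subring] integral_closure_incl[OF S_subring] by (auto simp: N_def)
  have C: "prime_in N (C \<sigma>)" "C \<sigma> \<inter> S = P" if "\<sigma> \<in> embeddings F" for \<sigma>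
    using conjugate_prime[OF that] by (simp_all add: C_def N_def)
  have incomp: "r = s" if "prime_in N r" "prime_in N s" "r \<subseteq> s" "r \<inter> S = P" "s \<inter> S = P" for r s
    using prime_over_incomparable[OF S ext_is_subfield[OF fin] ext_algebraic[OF fin] N that(1-3)] that(4,5)
    by simp
  \<comment> \<open>Primes over \<open>P\<close> are pairwise incomparable, and \<open>q\<close> is
    assumed to differ from all finitely many conjugate centres, so prime avoidance applies.\<close>
  have "\<exists>x\<in>q. \<forall>r\<in>C ` embeddings F. x \<notin> r"
  proof (rule prime_avoidance[OF N(1)])
    show "prime_in N q"
      using q(1) by (simp add: N_def)
    then show "\<not> q \<subseteq> r" if "r \<in> C ` embeddings F" for r
      using that neq C incomp q(2) by blast
    show "finite (C ` embeddings F)"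
      using finite_embeddings[OF fin] by blast
    show "prime_in N r" if "r \<in> C ` embeddings F" for r
      using that C by blast
    show "r = s" if "r \<in> C ` embeddings F" "s \<in> C ` embeddings F" "r \<subseteq> s" for r s
    proof (rule incomp)
      show "prime_in N r" "prime_in N s" "r \<subseteq> s" "r \<inter> S = P" "s \<inter> S = P"
        using that C by blast+
    qed
  qed
  then obtain x where x: "x \<in> q" "\<And>\<sigma>. \<sigma> \<in> embeddings F \<Longrightarrow> x \<notin> C \<sigma>"
    by blast
  have xN: "x \<in> N"
    using x(1) prime_inD(1)[OF q(1)] by (auto simp: N_def)
  obtain c A where c: "c \<in> F" "to_ac c = prod_mset A" "to_ac x \<in># A" "\<And>\<beta>. \<beta> \<in># A \<Longrightarrow> \<exists>\<sigma>\<in>embeddings F. \<sigma> x = \<beta>"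
    using exists_norm[OF fin, of x] by blast
  have "c \<in> q \<inter> S"
    using norm_in_prime[OF q(1) x(1) c] .
  then have "to_ac c \<in> nonunits W"
    using W(3) q(2) by blast
  \<comment> \<open>Each conjugate of \<open>x\<close> is in \<open>W\<close> but not in its prime
    ideal of nonunits, so no product of them is a nonunit. For the full multiset \<open>A\<close>
    this contradicts the norm lying in \<open>P\<close>.\<close>
  moreover have "prod_mset B \<notin> nonunits W" if "B \<subseteq># A" for B
    using that
  proof (induction B)
    case empty
    then show ?case
      using prime_inD(3)[OF prime_in_nonunits[OF W(1)]] by simp
  next
    case (add \<beta> B)
    have sub: "B \<subseteq># A"
      using add.prems by (meson mset_subset_eq_insertD subset_mset.less_imp_le)
    have conj: "\<gamma> \<in> W" "\<gamma> \<notin> nonunits W" if "\<gamma> \<in># A" for \<gamma>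
    proof -
      obtain \<sigma> where \<sigma>: "\<sigma> \<in> embeddings F" "\<sigma> x = \<gamma>"
        using c(4) \<open>\<gamma> \<in># A\<close> by blast
      show "\<gamma> \<in> W" "\<gamma> \<notin> nonunits W"
        using x(2)[OF \<sigma>(1)] \<sigma>(2) xN integral_closure_embedding[OF \<sigma>(1) W(1,2)] by (auto simp: C_def N_def)
    qed
    have "prod_mset B \<in> W"
      using conj(1) sub W(1) by (intro unital_subring_prod_mset) (auto simp: valring_def dest: mset_subset_eqD)
    moreover have "\<beta> \<in># A"
      using add.prems by (meson mset_subset_eq_insertD)
    ultimately show ?case
      using prime_inD(6)[OF prime_in_nonunits[OF W(1)], of \<beta> "prod_mset B"] conj add.IH[OF sub] by auto
  qed
  ultimately show False
    using c(2) by auto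
qed

end

text \<open>Contraction to the integral closure of \<open>S\<close> is injective on these primes by
  \<open>prime_overring_unique\<close>, and by \<open>prime_over_conjugate\<close> the contractions
  are indexed by embeddings.\<close>

theorem card_primes_over_le:
  assumes fin: "finite_field_extension F" and S: "valring_of F S" and P: "prime_in S P"
    and R: "unital_subring R" "S \<subseteq> R"
  defines "T \<equiv> {Q. prime_in (integral_closure R) Q \<and> Q \<inter> S = P}"
  shows "finite T" "card T \<le> separable_degree F"
proof -
  have S': "unital_subring S"
    using S by (simp add: valring_of_def)
  define N where "N = integral_closure S"
  define I where "I = integral_closure R"
  have I: "unital_subring I" "N \<subseteq> I" "S \<subseteq> N"
    using unital_subring_integral_closure[OF R(1)] integral_closure_eq_Inter_valring[OF S']
      integral_closure_eq_Inter_valring[OF R(1)] R(2) integral_closure_incl[OF S'] by (auto simp: I_def N_def)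
  obtain W where W: "valring W" "to_ac ` S \<subseteq> W" "\<And>x. x \<in> S \<Longrightarrow> to_ac x \<in> nonunits W \<longleftrightarrow> x \<in> P"
    using exists_valring_image_centre[OF hom_on_to_ac S' P] by blast
  have inj: "inj_on (\<lambda>Q. Q \<inter> N) T"
    using prime_overring_unique[OF S ext_is_subfield[OF fin] ext_algebraic[OF fin]] I
    by (intro inj_onI) (auto simp: T_def N_def I_def)
  have sub: "(\<lambda>Q. Q \<inter> N) ` T \<subseteq> (\<lambda>\<sigma>. \<sigma> -` nonunits W \<inter> N) ` embeddings F"
  proof safe
    fix Q assume "Q \<in> T"
    then have Q: "prime_in I Q" "Q \<inter> S = P"
      by (auto simp: T_def I_def)
    have "prime_in N (Q \<inter> N)"
      using prime_in_Int[OF Q(1) unital_subring_integral_closure[OF S']] I(2) by (simp add: N_def)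
    moreover have "Q \<inter> N \<inter> S = P"
      using Q(2) I(3) by blast
    ultimately show "Q \<inter> N \<in> (\<lambda>\<sigma>. \<sigma> -` nonunits W \<inter> N) ` embeddings F"
      using prime_over_conjugate[OF fin S P W, of "Q \<inter> N"] by (auto simp: N_def)
  qed
  have fe: "finite (embeddings F)"
    by (rule finite_embeddings[OF fin])
  then have "finite ((\<lambda>Q. Q \<inter> N) ` T)"
    by (rule finite_subset[OF sub finite_imageI])
  then show "finite T"
    using inj by (rule finite_imageD)
  have "card T = card ((\<lambda>Q. Q \<inter> N) ` T)"
    using card_image[OF inj] by simp
  also have "\<dots> \<le> card (embeddings F)"
    using surj_card_le[OF fe sub] .
  finally show "card T \<le> separable_degree F"
    by (simp add: separable_degree_eq)
qed


section \<open>Cardinality of spectra\<close>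

text \<open>When the spectrum is itself a chain, every finite set of primes is a chain, so the
  supremum runs over all finite subsets.\<close>

lemma krull_dim_eq_ecard_Spec:
  assumes "\<And>P Q. P \<in> Spec R \<Longrightarrow> Q \<in> Spec R \<Longrightarrow> P \<subseteq> Q \<or> Q \<subseteq> P"
  shows "krull_dim R = ecard (Spec R)"
proof -
  have "{C. C \<subseteq> Spec R \<and> finite C \<and> (\<forall>P\<in>C. \<forall>Q\<in>C. P \<subseteq> Q \<or> Q \<subseteq> P)} = {C. C \<subseteq> Spec R \<and> finite C}"
    using assms by blast
  then have eq: "krull_dim R = (SUP C\<in>{C. C \<subseteq> Spec R \<and> finite C}. enat (card C))"
    by (simp add: krull_dim_def)
  have ge: "enat (card C) \<le> krull_dim R" if "C \<subseteq> Spec R" "finite C" for C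
    unfolding eq by (rule SUP_upper) (use that in simp)
  show ?thesis
  proof (cases "finite (Spec R)")
    case True
    have "krull_dim R \<le> enat (card (Spec R))"
      unfolding eq by (rule SUP_least) (use True in \<open>auto intro: card_mono\<close>)
    then show ?thesis
      using ge[OF order_refl True] True by (simp add: ecard_def)
  next
    case False
    have "krull_dim R \<noteq> enat n" for n
    proof
      assume n: "krull_dim R = enat n"
      obtain C where C: "C \<subseteq> Spec R" "finite C" "card C = Suc n"
        using infinite_arbitrarily_large[OF False] by blast
      show False
        using ge[OF C(1,2)] C(3) n by simp
    qed
    then show ?thesis
      using False by (cases "krull_dim R") (auto simp: ecard_def)
  qed
qed

lemma ecard_le_surj:
  assumes "A \<subseteq> f ` B"
  shows "ecard A \<le> ecard B"
  using finite_surj[OF _ assms] surj_card_le[OF _ assms] by (auto simp: ecard_def)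

text \<open>\<open>A\<close> is the union of its fibres. For infinite \<open>B\<close> the bound is
  \<open>\<infinity>\<close>, where \<open>n > 0\<close> matters because
  \<open>0 * \<infinity> = 0\<close>.\<close>

lemma ecard_le_mult:
  assumes "\<And>b. b \<in> B \<Longrightarrow> finite {a\<in>A. f a = b}" "\<And>b. b \<in> B \<Longrightarrow> card {a\<in>A. f a = b} \<le> n"
    and "f ` A \<subseteq> B" "n > 0"
  shows "ecard A \<le> enat n * ecard B"
proof (cases "finite B")
  case True
  have A: "A = (\<Union>b\<in>B. {a\<in>A. f a = b})"
    using assms(3) by blast
  then have "finite A"
    using True assms(1) by (metis (no_types, lifting) finite_UN)
  have "card A \<le> (\<Sum>b\<in>B. card {a\<in>A. f a = b})"
    using card_UN_le[OF True, of "\<lambda>b. {a\<in>A. f a = b}"] A by simp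
  also have "\<dots> \<le> (\<Sum>b\<in>B. n)"
    by (rule sum_mono) (rule assms(2))
  finally show ?thesis
    using True \<open>finite A\<close> by (simp add: ecard_def mult.commute)
next
  case False
  then show ?thesis
    using assms(4) by (simp add: ecard_def enat_0_iff)
qed

section \<open>The rings belonging to \<open>w\<close> and \<open>v\<close>\<close>

lemma unital_subring_quasi_valuation_ring:
  assumes "quasi_valuation w" "w 1 = 0" "w (- 1) = 0"
  shows "unital_subring (quasi_valuation_ring w)"
proof -
  have add: "0 \<le> a + b" if "0 \<le> a" "0 \<le> b" for a b :: "'b with_infty"
    using that by (cases a; cases b) (auto simp: zero_with_infty_def)
  have mult: "0 \<le> w (x * y)" if "0 \<le> w x" "0 \<le> w y" for x y
    using assms(1) add[OF that] unfolding quasi_valuation_def by (meson order_trans)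
  have "0 \<le> w (x + y)" if "0 \<le> w x" "0 \<le> w y" for x y
    using assms(1) that unfolding quasi_valuation_def by (meson min.bounded_iff order_trans)
  moreover have "0 \<le> w (- x)" if "0 \<le> w x" for x
    using mult[of "- 1" x] that assms(3) by simp
  moreover have "0 \<le> w 0"
    using assms(1) by (simp add: quasi_valuation_def infinity_with_infty_def)
  ultimately show ?thesis
    using mult assms(2) by (auto simp: unital_subring_def quasi_valuation_ring_def)
qed

lemma valuation_units:
  fixes v :: "'a::field \<Rightarrow> 'g::linordered_ab_group_add with_infty"
  assumes v: "valuation F v" and F: "is_subfield F"
  shows "v 1 = 0" "v (- 1) = 0" "x \<in> F \<Longrightarrow> v (- x) = v x"
    "x \<in> F \<Longrightarrow> x \<noteq> 0 \<Longrightarrow> v x = Val g \<Longrightarrow> v (inverse x) = Val (- g)"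
proof -
  have F': "unital_subring F"
    using F by (simp add: is_subfield_def)
  note FD = unital_subringD[OF F']
  have v: "v (x * y) = v x + v y" "v x = Infty \<longleftrightarrow> x = 0" if "x \<in> F" "y \<in> F" for x y
    using v that by (auto simp: valuation_def infinity_with_infty_def)
  obtain a where a: "v 1 = Val a"
    using v(2)[OF FD(2,2)] by (cases "v 1") auto
  show v1: "v 1 = 0"
    using v(1)[OF FD(2,2)] a by (simp add: zero_with_infty_def)
  have m1: "- 1 \<in> F"
    using FD(2,3) by blast
  obtain b where b: "v (- 1) = Val b"
    using v(2)[OF m1 m1] by (cases "v (- 1)") auto
  \<comment> \<open>Twice this value is \<open>v 1 = 0\<close>, and an ordered group is
    torsion-free.\<close>
  show m: "v (- 1) = 0"
    using v(1)[OF m1 m1] b v1 by (simp add: zero_with_infty_def)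
  show "v (- x) = v x" if "x \<in> F"
    using v(1)[OF m1 that] m by simp
  show "v (inverse x) = Val (- g)" if x: "x \<in> F" "x \<noteq> 0" "v x = Val g"
  proof -
    have ix: "inverse x \<in> F"
      using F x by (simp add: is_subfield_def)
    obtain h where h: "v (inverse x) = Val h"
      using v(2)[OF ix ix] x(2) by (cases "v (inverse x)") auto
    have "g + h = 0"
      using v(1)[OF x(1) ix] x v1 h by (simp add: zero_with_infty_def)
    then show ?thesis
      using h by (simp add: eq_neg_iff_add_eq_0 add.commute)
  qed
qed

lemma valring_of_valuation_ring:
  assumes v: "valuation F v" and F: "is_subfield F"
  shows "valring_of F (valuation_ring F v)"
proof -
  have F': "unital_subring F"
    using F by (simp add: is_subfield_def)
  note FD = unital_subringD[OF F']
  have v': "v (x * y) = v x + v y" "min (v x) (v y) \<le> v (x + y)" "v x = Infty \<longleftrightarrow> x = 0" if "x \<in> F" "y \<in> F" for x y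
    using v that by (auto simp: valuation_def infinity_with_infty_def)
  have add: "0 \<le> a + b" if "0 \<le> a" "0 \<le> b" for a b :: "'b with_infty"
    using that by (cases a; cases b) (auto simp: zero_with_infty_def)
  have "unital_subring (valuation_ring F v)"
    unfolding unital_subring_def valuation_ring_def
  proof (intro conjI ballI; clarsimp simp: FD valuation_units[OF v F] v')
    show "0 \<le> v 0"
      using v'(3)[OF FD(1,1)] by simp
    show "0 \<le> v (x + y)" if "x \<in> F" "0 \<le> v x" "y \<in> F" "0 \<le> v y" for x y
      using v'(2)[OF that(1,3)] that(2,4) by (meson min.boundedI order_trans)
  qed (auto intro: add)
  moreover have "inverse x \<in> valuation_ring F v" if x: "x \<in> F" "x \<notin> valuation_ring F v" for x
  proof -
    have lt: "\<not> 0 \<le> v x"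
      using x by (auto simp: valuation_ring_def)
    then obtain g where g: "v x = Val g" "g < 0"
      by (cases "v x") (auto simp: zero_with_infty_def)
    then have "x \<noteq> 0"
      using v'(3)[OF x(1,1)] by auto
    then have "v (inverse x) = Val (- g)"
      using valuation_units(4)[OF v F x(1)] g(1) by blast
    then show ?thesis
      using g(2) x(1) F by (auto simp: valuation_ring_def zero_with_infty_def is_subfield_def)
  qed
  ultimately show ?thesis
    by (auto simp: valring_of_def valuation_ring_def)
qed

theorem theorem5p21:
  fixes F :: "'e::field set"
    and v :: "'e \<Rightarrow> 'g::linordered_ab_group_add with_infty"
    and w :: "'e \<Rightarrow> 'm::{linorder, ordered_comm_monoid_add} with_infty"
    and \<iota> :: "'g \<Rightarrow> 'm"
  assumes "finite_field_extension F"
    and "valuation F v"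
    and "quasi_valuation w"
    and "ordered_monoid_embedding (value_group F v) \<iota>"
    and w_extends_v: "\<forall>x\<in>F. w x = map_with_infty \<iota> (v x)"
    and "torsion_over w (\<iota> ` value_group F v)"
  defines "O\<^sub>v \<equiv> valuation_ring F v"
    and "O\<^sub>w \<equiv> quasi_valuation_ring w"
  shows "krull_dim (subring_of_field O\<^sub>v) \<le> ecard (Spec (subring_of_field O\<^sub>w)) \<and>
         lepoll (Spec (subring_of_field O\<^sub>w)) (Spec (subring_of_field (integral_closure O\<^sub>w))) \<and>
         ecard (Spec (subring_of_field (integral_closure O\<^sub>w)))
           \<le> enat (separable_degree F) * krull_dim (subring_of_field O\<^sub>v)"
proof -
  note fin = assms(1) and v = assms(2) and \<iota> = assms(4)
  have F: "is_subfield F" "unital_subring F"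
    using ext_is_subfield[OF fin] by (auto simp: is_subfield_def)
  note FD = unital_subringD[OF F(2)]
  have S: "valring_of F O\<^sub>v" "unital_subring O\<^sub>v"
    using valring_of_valuation_ring[OF v F(1)] by (auto simp: O\<^sub>v_def valring_of_def)
  have \<iota>0: "\<iota> 0 = 0" and \<iota>_mono: "\<And>a b. a \<in> value_group F v \<Longrightarrow> b \<in> value_group F v \<Longrightarrow> \<iota> a \<le> \<iota> b \<longleftrightarrow> a \<le> b"
    using \<iota> by (auto simp: ordered_monoid_embedding_def strict_mono_on_less_eq)
  have "- 1 \<in> F"
    using FD(2,3) by blast
  \<comment> \<open>The axioms of a quasi-valuation leave these two values open; here they are
    inherited from \<open>v\<close>.\<close>
  then have "w 1 = 0" "w (- 1) = 0"
    using w_extends_v valuation_units(1,2)[OF v F(1)] FD(2) \<iota>0 by (auto simp: zero_with_infty_def)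
  then have R: "unital_subring O\<^sub>w"
    using unital_subring_quasi_valuation_ring assms(3) by (auto simp: O\<^sub>w_def)
  \<comment> \<open>The embedding \<open>\<iota>\<close> preserves and reflects the order on the
    value group, which contains 0, so \<open>v\<close> and \<open>w\<close> have the same
    nonnegative elements in \<open>F\<close>.\<close>
  have "0 \<le> w x \<longleftrightarrow> 0 \<le> v x" if "x \<in> F" for x
  proof (cases "v x")
    case (Val g)
    then have "x \<noteq> 0"
      using v that by (auto simp: valuation_def infinity_with_infty_def)
    then have "g \<in> value_group F v"
      using Val that by (auto simp: value_group_def)
    moreover have "0 \<in> value_group F v"
      using valuation_units(1)[OF v F(1)] FD(2) by (auto simp: value_group_def zero_with_infty_def)
    ultimately show ?thesis
      using Val w_extends_v that \<iota>_mono[of 0 g] \<iota>0 by (auto simp: zero_with_infty_def)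
  next
    case Infty
    then show ?thesis
      using w_extends_v that by simp
  qed
  then have RF: "O\<^sub>w \<inter> F = O\<^sub>v"
    by (auto simp: O\<^sub>w_def O\<^sub>v_def quasi_valuation_ring_def valuation_ring_def)
  have I: "unital_subring (integral_closure O\<^sub>w)" "O\<^sub>w \<subseteq> integral_closure O\<^sub>w"
    using unital_subring_integral_closure[OF R] integral_closure_incl[OF R] by auto
  have Spec: "Spec (subring_of_field O\<^sub>v) = {P. prime_in O\<^sub>v P}" "Spec (subring_of_field O\<^sub>w) = {P. prime_in O\<^sub>w P}"
    "Spec (subring_of_field (integral_closure O\<^sub>w)) = {P. prime_in (integral_closure O\<^sub>w) P}"
    using Spec_subring_of_field S(2) R I(1) by auto
  have dim: "krull_dim (subring_of_field O\<^sub>v) = ecard {P. prime_in O\<^sub>v P}"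
    using krull_dim_eq_ecard_Spec[of "subring_of_field O\<^sub>v"] valring_of_prime_total[OF S(1) F(1)]
    by (simp add: Spec)
  show ?thesis
    unfolding dim Spec
  proof (intro conjI)
    show "ecard {P. prime_in O\<^sub>v P} \<le> ecard {P. prime_in O\<^sub>w P}"
      using exists_prime_over_valring_of[OF S(1) F(1) R RF] by (intro ecard_le_surj[where f = "\<lambda>Q. Q \<inter> O\<^sub>v"]) blast
    have "{P. prime_in O\<^sub>w P} \<subseteq> (\<lambda>Q. Q \<inter> O\<^sub>w) ` {P. prime_in (integral_closure O\<^sub>w) P}"
      using exists_prime_over_integral_closure[OF R] by blast
    then show "lepoll {P. prime_in O\<^sub>w P} {P. prime_in (integral_closure O\<^sub>w) P}"
      by (meson image_lepoll lepoll_trans subset_imp_lepoll)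
    \<comment> \<open>Fibre counting for contraction to \<open>O\<^sub>v\<close>: each fibre has at
      most \<open>separable_degree F\<close> members, and the base is the chain of primes whose size
      is the Krull dimension.\<close>
    show "ecard {P. prime_in (integral_closure O\<^sub>w) P} \<le> enat (separable_degree F) * ecard {P. prime_in O\<^sub>v P}"
    proof (rule ecard_le_mult[where f = "\<lambda>Q. Q \<inter> O\<^sub>v"])
      show "finite {Q \<in> {P. prime_in (integral_closure O\<^sub>w) P}. Q \<inter> O\<^sub>v = P}"
        "card {Q \<in> {P. prime_in (integral_closure O\<^sub>w) P}. Q \<inter> O\<^sub>v = P} \<le> separable_degree F"
        if "P \<in> {P. prime_in O\<^sub>v P}" for P
        using card_primes_over_le[OF fin S(1) _ R, of P] that RF by auto
      show "(\<lambda>Q. Q \<inter> O\<^sub>v) ` {P. prime_in (integral_closure O\<^sub>w) P} \<subseteq> {P. prime_in O\<^sub>v P}"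
        using prime_in_Int[OF _ S(2)] I(2) RF by auto
      show "0 < separable_degree F"
        using finite_embeddings[OF fin] embeddings_nonempty[OF fin] by (simp add: separable_degree_eq card_gt_0_iff)
    qed
  qed
qed

end
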